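(* Let $G$ be a connected graph with maximum degree $\Delta(G)=4$ and $\Delta(G_\Delta)\le 2$. Then $G$ is class 2 if and only if $G$ is (isomorphic to) $K_5-e$.
   Context: Graphs are finite and simple. $\Delta(H)$ denotes the maximum degree of a graph $H$, and $\chi'(G)$ is the edge-chromatic number (the minimum number of colors in an edge-coloring in which any two distinct edges sharing an endpoint get different colors). $G_\Delta$ is the subgraph of $G$ induced by the vertices of degree $\Delta(G)$ in $G$. A graph $G$ is class 1 if $\chi'(G)=\Delta(G)$, and class 2 otherwise. $K_5-e$ is the complete graph on 5 vertices with one edge deleted. *)

theory Defs
  imports "HOL-Library.Ramsey"
begin

datatype 'a graph = Graph (verts: "'a set") (edges: "'a set set")

definition simple_graph :: "'a graph \<Rightarrow> bool" where
  "simple_graph G \<longleftrightarrow> finite (verts G) \<and> edges G \<subseteq> nsets (verts G) 2"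

definition adjacent :: "'a graph \<Rightarrow> 'a \<Rightarrow> 'a \<Rightarrow> bool" where
  "adjacent G u v \<longleftrightarrow> {u, v} \<in> edges G"

definition connected_graph :: "'a graph \<Rightarrow> bool" where
  "connected_graph G \<longleftrightarrow>
     verts G \<noteq> {} \<and> (\<forall>u \<in> verts G. \<forall>v \<in> verts G. (adjacent G)\<^sup>*\<^sup>* u v)"

definition vertex_degree :: "'a graph \<Rightarrow> 'a \<Rightarrow> nat" where
  "vertex_degree G v = card {e \<in> edges G. v \<in> e}"

text \<open>The inserted \<open>0\<close> only matters for the graph without vertices, whose
  maximum degree is \<open>0\<close> by convention.\<close>

definition max_degree :: "'a graph \<Rightarrow> nat" where
  "max_degree G = Max (insert 0 (vertex_degree G ` verts G))"

definition induced_subgraph :: "'a graph \<Rightarrow> 'a set \<Rightarrow> 'a graph" where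
  "induced_subgraph G S = Graph (verts G \<inter> S) {e \<in> edges G. e \<subseteq> S}"

text \<open>The graph $G_\Delta$.\<close>

definition core :: "'a graph \<Rightarrow> 'a graph" where
  "core G = induced_subgraph G {v \<in> verts G. vertex_degree G v = max_degree G}"

definition proper_edge_coloring :: "'a graph \<Rightarrow> ('a set \<Rightarrow> 'c) \<Rightarrow> bool" where
  "proper_edge_coloring G c \<longleftrightarrow>
     (\<forall>e \<in> edges G. \<forall>f \<in> edges G. e \<noteq> f \<and> e \<inter> f \<noteq> {} \<longrightarrow> c e \<noteq> c f)"

definition edge_colorable :: "'a graph \<Rightarrow> nat \<Rightarrow> bool" where
  "edge_colorable G k \<longleftrightarrow>
     (\<exists>c :: 'a set \<Rightarrow> nat. proper_edge_coloring G c \<and> c ` edges G \<subseteq> {..<k})"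

definition chromatic_index :: "'a graph \<Rightarrow> nat" where
  "chromatic_index G = (LEAST k. edge_colorable G k)"

lemma simple_graph_finite_edges:
  assumes "simple_graph G"
  shows "finite (edges G)"
  using assms finite_imp_finite_nsets finite_subset
  unfolding simple_graph_def by blast

text \<open>The least number in \<^const>\<open>chromatic_index\<close> is attained for simple graphs.\<close>

lemma edge_colorable_chromatic_index:
  assumes "simple_graph G"
  shows "edge_colorable G (chromatic_index G)"
proof -
  have "finite (edges G)"
    using assms by (rule simple_graph_finite_edges)
  then obtain c :: "'a set \<Rightarrow> nat" where c: "bij_betw c (edges G) {0..<card (edges G)}"
    using ex_bij_betw_finite_nat by blast
  then have "proper_edge_coloring G c"
    unfolding proper_edge_coloring_def bij_betw_def inj_on_def by blast
  moreover have "c ` edges G \<subseteq> {..<card (edges G)}"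
    using c by (auto simp: bij_betw_def)
  ultimately have "edge_colorable G (card (edges G))"
    unfolding edge_colorable_def by blast
  then show ?thesis
    unfolding chromatic_index_def by (rule LeastI)
qed

definition class1 :: "'a graph \<Rightarrow> bool" where
  "class1 G \<longleftrightarrow> chromatic_index G = max_degree G"

definition class2 :: "'a graph \<Rightarrow> bool" where
  "class2 G \<longleftrightarrow> \<not> class1 G"

definition graph_isomorphic :: "'a graph \<Rightarrow> 'b graph \<Rightarrow> bool" where
  "graph_isomorphic G H \<longleftrightarrow>
     (\<exists>f. bij_betw f (verts G) (verts H) \<and>
          (\<forall>u \<in> verts G. \<forall>v \<in> verts G. adjacent G u v \<longleftrightarrow> adjacent H (f u) (f v)))"

definition complete_graph :: "nat \<Rightarrow> nat graph" where
  "complete_graph n = Graph {..<n} (nsets {..<n} 2)"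

definition delete_edge :: "'a graph \<Rightarrow> 'a set \<Rightarrow> 'a graph" where
  "delete_edge G e = Graph (verts G) (edges G - {e})"

text \<open>Up to isomorphism the choice of the deleted edge is irrelevant.\<close>

definition K5_minus_edge :: "nat graph" where
  "K5_minus_edge = delete_edge (complete_graph 5) {0, 1}"

end

theory Submission
  imports Defs "HOL-Combinatorics.List_Permutation"
begin

text \<open>
  One direction is a count. \<open>K\<^sub>5 - e\<close> has nine edges, and a color class on five vertices has at
  most two, so four colors cover at most eight of them.

  For the other direction, a graph that is not 4-edge-colorable contains a \<^emph>\<open>critical\<close> set \<open>E\<close> of
  edges: \<open>E\<close> has no proper 4-coloring, but every \<open>E - {e}\<close> has one. What has to be shown about \<open>E\<close>
  is local, and all local arguments have the same form. Erase the colors on a few edges near a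
  vertex and note, for each vertex involved, which colors are now missing there. If the erased
  edges can be colored from these lists, \<open>E\<close> would be colorable. Otherwise recolor: swap two
  colors \<open>a\<close>, \<open>b\<close> along the Kempe chain that starts at a noted vertex where exactly one of them is
  missing. The chain is a path. Hence it ends either at one other such vertex or outside the noted
  vertices, and the lists change only at its noted ends. Nothing else about the rest of the graph
  matters. So each local argument is a finite game against an opponent who decides where the
  chains end. \<open>wins_sound\<close> says that a winning strategy, a finite tree, yields a coloring. The
  strategies below come from an exhaustive search; checking one is a computation on lists of truth
  values, and the same game also does the work of Vizing's adjacency lemma.

  Playing the game gives, step by step, the structure of \<open>E\<close>, where the hypothesis on the core
  says that a vertex of degree 4 has at most two neighbors of degree 4.

    \<^item> Some vertex has degree 4, and each vertex of degree 4 has exactly two neighbors of degree 4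
      and two of degree 3 (\<open>exists_degree_4\<close>, \<open>star_exists\<close>).

    \<^item> Adjacent vertices \<open>r\<close>, \<open>v\<close> of degree 4 have the same two neighbors of degree 3
      (\<open>same_low_neighbors\<close>). Sharing exactly one is impossible. If they share none, the opponent
      can be forced into the single position \<open>pair_position\<close> at the edge \<open>rv\<close>. From there the game
      is won as soon as the other neighbor \<open>u\<close> of \<open>r\<close> of degree 4 joins in with its two neighbors
      of degree 3, however these coincide with those of \<open>r\<close> and \<open>v\<close>.

    \<^item> Therefore a neighbor \<open>s\<close> of \<open>r\<close> of degree 3 is adjacent to every vertex of degree 4 that can
      be reached from \<open>r\<close> through vertices of degree 4. There are only three of these, so they
      form a triangle, and together with their two common neighbors a \<open>K\<^sub>5 - e\<close>
      (\<open>K5_minus_edge_structure\<close>).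

  In the graph itself the three vertices of the triangle have all their edges in \<open>E\<close>, and a common
  neighbor of them cannot have degree 4, since it would then have three neighbors in the core. So
  this \<open>K\<^sub>5 - e\<close> is a connected component, hence the whole graph.\<close>

section \<open>Partial edge colorings and Kempe chains\<close>

definition coloring :: "nat \<Rightarrow> 'a set set \<Rightarrow> ('a set \<Rightarrow> nat) \<Rightarrow> bool" where
  "coloring k F c \<longleftrightarrow> (\<forall>e\<in>F. c e < k) \<and> (\<forall>e\<in>F. \<forall>f\<in>F. e \<noteq> f \<and> e \<inter> f \<noteq> {} \<longrightarrow> c e \<noteq> c f)"

definition missing :: "'a set set \<Rightarrow> ('a set \<Rightarrow> nat) \<Rightarrow> nat \<Rightarrow> 'a \<Rightarrow> bool" where
  "missing F c i v \<longleftrightarrow> (\<forall>e\<in>F. v \<in> e \<longrightarrow> c e \<noteq> i)"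

text \<open>
  A position of the game: the edges in \<open>F\<close> are colored, and color \<open>i\<close> is missing at every vertex
  of the \<open>i\<close>-th set. The sets need not contain all such vertices. This makes upper bounds on
  degrees as good as exact degrees, because surplus missing colors are just not recorded.\<close>

definition position :: "'a set set \<Rightarrow> 'a set list \<Rightarrow> bool" where
  "position F Xs \<longleftrightarrow>
     (\<exists>c. coloring (length Xs) F c \<and> (\<forall>i<length Xs. \<forall>v\<in>Xs ! i. missing F c i v))"

text \<open>
  The abstract form of a Kempe chain. Think of \<open>f\<close> and \<open>g\<close> as moving along the edge of the first
  or second color, with a fixed point where that color is missing. From \<open>v\<close>, where the chain
  cannot be continued by \<open>f\<close>, the walk that applies \<open>g\<close> and \<open>f\<close> alternately covers the component;
  at the first other fixed point it turns back. So a component has at most one end besides \<open>v\<close>.\<close>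

lemma involutions_chain_ends:
  fixes f g :: "'a \<Rightarrow> 'a"
  assumes f: "\<And>x. f (f x) = x" and g: "\<And>x. g (g x) = x" and v: "f v = v"
  obtains K w where "v \<in> K" "\<And>x. x \<in> K \<Longrightarrow> f x \<in> K \<and> g x \<in> K"
    "\<And>x. \<lbrakk>x \<in> K; f x = x \<or> g x = x\<rbrakk> \<Longrightarrow> x = v \<or> x = w"
proof -
  define z where "z = rec_nat v (\<lambda>n y. if even n then g y else f y)"
  have z0: "z 0 = v" and zS: "z (Suc n) = (if even n then g (z n) else f (z n))" for n
    by (simp_all add: z_def)
  have undo: "(if even n then g (z (Suc n)) else f (z (Suc n))) = z n" for n
    by (simp add: zS f g)
  have fz: "f (z n) = (if even n then if n = 0 then v else z (n - 1) else z (Suc n))" for n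
    using undo[of "n - 1"] by (cases n) (auto simp: zS z0 v)
  have gz: "g (z n) = (if even n then z (Suc n) else z (n - 1))" for n
    using undo[of "n - 1"] by (cases n) (auto simp: zS)
  have closed: "f x \<in> range z \<and> g x \<in> range z" if "x \<in> range z" for x
  proof -
    obtain n where "x = z n" using \<open>x \<in> range z\<close> by auto
    moreover have "v = z 0" by (simp add: z0)
    ultimately show ?thesis by (auto simp: fz gz)
  qed
  have vz: "v \<in> range z"
    by (metis z0 rangeI)
  show thesis
  proof (cases "\<exists>n. z n \<noteq> v \<and> (f (z n) = z n \<or> g (z n) = z n)")
    case False
    then show thesis
      using vz closed that[of "range z" v] by blast
  next
    case True
    define j where "j = (LEAST n. z n \<noteq> v \<and> (f (z n) = z n \<or> g (z n) = z n))"
    have j: "z j \<noteq> v" "f (z j) = z j \<or> g (z j) = z j"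
      using LeastI_ex[OF True] unfolding j_def by auto
    have least: "\<not> (z i \<noteq> v \<and> (f (z i) = z i \<or> g (z i) = z i))" if "i < j" for i
      using not_less_Least[of i] that unfolding j_def by auto
    obtain j' where j': "j = Suc j'"
      using j(1) z0 by (cases j) auto
    \<comment> \<open>If the step into \<open>z j\<close> did not move, \<open>z j'\<close> would already be an end.\<close>
    have "z j' \<noteq> z j"
    proof
      assume eq: "z j' = z j"
      then show False
        using least[of j'] j' j by auto
    qed
    then have end_j: "z (Suc j) = z j"
      using j(2) j' fz[of j] gz[of j] by (auto split: if_splits)
    \<comment> \<open>The walk turns back at \<open>z j\<close> and never leaves the vertices seen so far.\<close>
    have bound: "z n \<in> z ` {..j}" for n
    proof (induction n)
      case 0
      then show ?case by simp
    next
      case (Suc n)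
      then obtain i where i: "z n = z i" "i \<le> j" by auto
      have near: "f (z i) \<in> z ` {..j} \<and> g (z i) \<in> z ` {..j}"
      proof (cases "i = j")
        case True
        then show ?thesis
          using end_j j' by (auto simp: fz gz)
      next
        case False
        then show ?thesis
          using i(2) z0 by (auto simp: fz gz Suc_le_eq intro: imageI)
      qed
      then show ?case
        using i(1) by (simp add: zS)
    qed
    have "x = v \<or> x = z j" if "x \<in> range z" "f x = x \<or> g x = x" for x
    proof -
      obtain i where "x = z i" "i \<le> j"
        using \<open>x \<in> range z\<close> bound by blast
      then show ?thesis
        using least[of i] that(2) by (cases "i = j") auto
    qed
    then show thesis
      using vz closed that[of "range z" "z j"] by blast
  qed
qed

text \<open>
  The fixed points stand for missing edges and make \<open>mate F c i\<close> a total involution.\<close>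

definition mate :: "'a set set \<Rightarrow> ('a set \<Rightarrow> nat) \<Rightarrow> nat \<Rightarrow> 'a \<Rightarrow> 'a" where
  "mate F c i x = (if missing F c i x then x else SOME y. {x, y} \<in> F \<and> c {x, y} = i)"

lemma mate_eq:
  assumes "coloring k F c" "\<And>e. e \<in> F \<Longrightarrow> card e = 2" "{x, y} \<in> F" "c {x, y} = i"
  shows "mate F c i x = y"
proof -
  have "\<not> missing F c i x"
    using assms(3,4) unfolding missing_def by blast
  moreover have uniq: "y' = y" if "{x, y'} \<in> F \<and> c {x, y'} = i" for y'
  proof -
    have "{x, y'} \<inter> {x, y} \<noteq> {}" by simp
    then have "{x, y'} = {x, y}"
      using assms(1,3,4) that unfolding coloring_def by metis
    then show ?thesis by (auto simp: doubleton_eq_iff)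
  qed
  moreover have "(SOME y'. {x, y'} \<in> F \<and> c {x, y'} = i) = y"
    using assms(3,4) uniq by (intro some_equality) blast+
  ultimately show ?thesis
    by (simp add: mate_def)
qed

lemma mate_edge:
  assumes "\<And>e. e \<in> F \<Longrightarrow> card e = 2" "\<not> missing F c i x"
  shows "{x, mate F c i x} \<in> F \<and> c {x, mate F c i x} = i"
proof -
  obtain e where e: "e \<in> F" "x \<in> e" "c e = i"
    using assms(2) unfolding missing_def by blast
  then obtain y where "e = {x, y}"
    using assms(1) by (metis card_2_iff doubleton_eq_iff insert_iff singletonD)
  then have "\<exists>y. {x, y} \<in> F \<and> c {x, y} = i"
    using e by blast
  then show ?thesis
    unfolding mate_def using assms(2) someI_ex[of "\<lambda>y. {x, y} \<in> F \<and> c {x, y} = i"] by simp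
qed

lemma mate_mate:
  assumes "coloring k F c" "\<And>e. e \<in> F \<Longrightarrow> card e = 2"
  shows "mate F c i (mate F c i x) = x"
proof (cases "missing F c i x")
  case True
  then show ?thesis by (simp add: mate_def)
next
  case False
  from mate_edge[OF assms(2) False] show ?thesis
    using mate_eq[OF assms, of "mate F c i x" x] by (simp add: insert_commute)
qed

text \<open>
  \<open>K\<close> is the vertex set of the \<open>a\<close>-\<open>b\<close> chain at \<open>v\<close>. Every edge of color \<open>a\<close> or \<open>b\<close> that meets \<open>K\<close>
  lies inside \<open>K\<close>, so exchanging the two colors on these edges exchanges the roles of \<open>a\<close> and \<open>b\<close>
  at the vertices of \<open>K\<close> and changes nothing elsewhere.\<close>

lemma kempe_swap:
  assumes c: "coloring k F c" and F: "\<And>e. e \<in> F \<Longrightarrow> card e = 2"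
    and ab: "a < k" "b < k" and v: "missing F c a v \<or> missing F c b v"
  shows "\<exists>K w c'. v \<in> K \<and> coloring k F c' \<and>
    (\<forall>i x. missing F c' i x \<longleftrightarrow> missing F c (if x \<in> K then transpose a b i else i) x) \<and>
    (\<forall>x\<in>K. missing F c a x \<or> missing F c b x \<longrightarrow> x = v \<or> x = w)"
proof -
  let ?f = "mate F c a" and ?g = "mate F c b"
  have inv: "?f (?f x) = x" "?g (?g x) = x" for x
    using mate_mate[OF c F] by auto
  obtain K w where K: "v \<in> K" "\<And>x. x \<in> K \<Longrightarrow> ?f x \<in> K \<and> ?g x \<in> K"
    "\<And>x. \<lbrakk>x \<in> K; ?f x = x \<or> ?g x = x\<rbrakk> \<Longrightarrow> x = v \<or> x = w"
  proof (cases "missing F c a v")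
    case True
    then have "?f v = v" by (simp add: mate_def)
    with inv show ?thesis using involutions_chain_ends[of ?f ?g v] that by metis
  next
    case False
    then have "?g v = v" using v by (simp add: mate_def)
    with inv show ?thesis using involutions_chain_ends[of ?g ?f v] that by metis
  qed
  have inside: "e \<subseteq> K" if "e \<in> F" "c e = a \<or> c e = b" "x \<in> e" "x \<in> K" for e x
  proof -
    obtain y where "e = {x, y}"
      using F[OF \<open>e \<in> F\<close>] \<open>x \<in> e\<close> by (metis card_2_iff doubleton_eq_iff insert_iff singletonD)
    then show ?thesis
      using that K(2)[of x] mate_eq[OF c F, of x y] by auto
  qed
  define c' where "c' e = (if e \<subseteq> K then transpose a b (c e) else c e)" for e
  have c'_at: "c' e = (if x \<in> K then transpose a b (c e) else c e)" if "e \<in> F" "x \<in> e" for e x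
    using inside[OF that(1) _ that(2)] that unfolding c'_def
    by (auto simp: transpose_def subset_iff)
  have "c' e \<noteq> c' f" if "e \<in> F" "f \<in> F" "e \<noteq> f" "e \<inter> f \<noteq> {}" for e f
  proof -
    obtain x where "x \<in> e" "x \<in> f" using \<open>e \<inter> f \<noteq> {}\<close> by auto
    moreover have "c e \<noteq> c f" using c that unfolding coloring_def by auto
    ultimately show ?thesis
      using that c'_at by (auto simp: transpose_eq_iff)
  qed
  moreover have "c' e < k" if "e \<in> F" for e
    using c that ab unfolding coloring_def c'_def by (auto simp: transpose_def)
  ultimately have "coloring k F c'"
    unfolding coloring_def by blast
  moreover have "missing F c' i x \<longleftrightarrow> missing F c (if x \<in> K then transpose a b i else i) x" for i x
    unfolding missing_def using c'_at by (auto simp: transpose_eq_iff)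
  moreover have "x = v \<or> x = w" if "x \<in> K" "missing F c a x \<or> missing F c b x" for x
  proof -
    have "?f x = x \<or> ?g x = x"
      using that(2) by (auto simp: mate_def)
    then show ?thesis using K(3) that(1) by blast
  qed
  ultimately show ?thesis
    using K(1) by blast
qed

text \<open>
  The effect of a Kempe swap on a position. Vertices of the chain that are in both sets or in
  neither keep their record, so only the recorded ends are exchanged. If the chain has no recorded
  end besides \<open>v\<close>, then \<open>w = v\<close>.\<close>

lemma position_kempe:
  assumes pos: "position F Xs" and F: "\<And>e. e \<in> F \<Longrightarrow> card e = 2"
    and ab: "a < length Xs" "b < length Xs" "a \<noteq> b"
    and v: "v \<in> (Xs ! a - Xs ! b) \<union> (Xs ! b - Xs ! a)"
  obtains w where "w \<in> (Xs ! a - Xs ! b) \<union> (Xs ! b - Xs ! a)"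
    "position F (Xs[a := (Xs ! a - {v, w}) \<union> (Xs ! b \<inter> {v, w}),
                    b := (Xs ! b - {v, w}) \<union> (Xs ! a \<inter> {v, w})])"
proof -
  obtain c where c: "coloring (length Xs) F c"
    and m: "\<And>i x. i < length Xs \<Longrightarrow> x \<in> Xs ! i \<Longrightarrow> missing F c i x"
    using pos unfolding position_def by blast
  have "missing F c a v \<or> missing F c b v"
    using v m ab by blast
  from kempe_swap[OF c F ab(1,2) this]
  obtain K w c' where K: "v \<in> K" and c': "coloring (length Xs) F c'"
    and m': "\<And>i x. missing F c' i x \<longleftrightarrow> missing F c (if x \<in> K then transpose a b i else i) x"
    and ends: "\<And>x. \<lbrakk>x \<in> K; missing F c a x \<or> missing F c b x\<rbrakk> \<Longrightarrow> x = v \<or> x = w"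
    by blast
  define D where "D = (Xs ! a - Xs ! b) \<union> (Xs ! b - Xs ! a)"
  \<comment> \<open>The other end of the chain counts only if the record of the two colors differs there.\<close>
  define w' where "w' = (if w \<in> K \<inter> D then w else v)"
  have P: "{v, w'} = K \<inter> D"
    using K v ends m ab unfolding w'_def D_def by auto
  let ?Ys = "Xs[a := (Xs ! a - {v, w'}) \<union> (Xs ! b \<inter> {v, w'}), b := (Xs ! b - {v, w'}) \<union> (Xs ! a \<inter>
      {v, w'})]"
  have "missing F c' i x" if "i < length ?Ys" "x \<in> ?Ys ! i" for i x
  proof -
    consider "i = a" | "i = b" | "i \<noteq> a" "i \<noteq> b" by blast
    then show ?thesis
    proof cases
      case 1
      then have "x \<in> (Xs ! a - K \<inter> D) \<union> (Xs ! b \<inter> (K \<inter> D))"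
        using that ab P by simp
      then show ?thesis
        using m[OF ab(1), of x] m[OF ab(2), of x] 1 unfolding m' D_def by auto
    next
      case 2
      then have "x \<in> (Xs ! b - K \<inter> D) \<union> (Xs ! a \<inter> (K \<inter> D))"
        using that ab P by simp
      then show ?thesis
        using m[OF ab(1), of x] m[OF ab(2), of x] 2 unfolding m' D_def by auto
    next
      case 3
      then show ?thesis
        using that m[of i x] unfolding m' by (auto simp: transpose_def)
    qed
  qed
  then have "position F ?Ys"
    unfolding position_def using c' by (intro exI[of _ c']) simp
  moreover have "w' \<in> D"
    using P by auto
  ultimately show thesis
    using that unfolding D_def by blast
qed

text \<open>
  The names of the colors do not matter.\<close>

lemma position_mset_cong:
  assumes "position F Xs" "mset Xs = mset Ys"
  shows "position F Ys"
proof -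
  obtain f where f: "bij_betw f {..<length Ys} {..<length Xs}" "\<And>i. i < length Ys
      \<Longrightarrow> Ys ! i = Xs ! f i"
    using permutation_Ex_bij[of Ys Xs] assms(2) by auto
  obtain c where c: "coloring (length Xs) F c"
    "\<And>i v. i < length Xs \<Longrightarrow> v \<in> Xs ! i \<Longrightarrow> missing F c i v"
    using assms(1) unfolding position_def by blast
  define g where "g = the_inv_into {..<length Ys} f"
  have g: "bij_betw g {..<length Xs} {..<length Ys}"
    unfolding g_def using f(1) by (rule bij_betw_the_inv_into)
  have gf: "g (f i) = i" if "i < length Ys" for i
    unfolding g_def using f(1) that by (simp add: bij_betw_def the_inv_into_f_f)
  have fg: "f (g i) = i" if "i < length Xs" for i
    unfolding g_def using f(1) that by (simp add: f_the_inv_into_f_bij_betw)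
  have lt: "c e < length Xs" if "e \<in> F" for e
    using c(1) that unfolding coloring_def by blast
  have "coloring (length Ys) F (\<lambda>e. g (c e))"
    unfolding coloring_def
  proof (intro conjI ballI impI)
    fix e assume "e \<in> F"
    then show "g (c e) < length Ys"
      using lt g by (metis bij_betw_apply lessThan_iff)
  next
    fix e e' assume "e \<in> F" "e' \<in> F" "e \<noteq> e' \<and> e \<inter> e' \<noteq> {}"
    then show "g (c e) \<noteq> g (c e')"
      using c(1) lt fg unfolding coloring_def by metis
  qed
  moreover have "missing F (\<lambda>e. g (c e)) i v" if "i < length Ys" "v \<in> Ys ! i" for i v
  proof -
    have "f i < length Xs"
      using f(1) that(1) by (metis bij_betw_apply lessThan_iff)
    then have "missing F c (f i) v"
      using c(2) f(2) that by metis
    then show ?thesis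
      using fg lt unfolding missing_def by metis
  qed
  ultimately show ?thesis
    unfolding position_def by blast
qed

lemma position_color:
  assumes "position F (X # Xs)" "e \<subseteq> X"
  shows "position (insert e F) ((X - e) # Xs)"
proof -
  obtain c where c: "coloring (length (X # Xs)) F c"
    and m: "\<And>i v. i < length (X # Xs) \<Longrightarrow> v \<in> (X # Xs) ! i \<Longrightarrow> missing F c i v"
    using assms(1) unfolding position_def by blast
  have m0: "missing F c 0 v" if "v \<in> X" for v
    using m[of 0 v] that by simp
  let ?c = "c(e := 0)"
  have new: "?c f \<noteq> 0" if "f \<in> F" "f \<noteq> e" "f \<inter> e \<noteq> {}" for f
  proof -
    obtain x where "x \<in> f" "x \<in> X"
      using \<open>f \<inter> e \<noteq> {}\<close> assms(2) by blast
    then have "c f \<noteq> 0"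
      using m0[of x] \<open>f \<in> F\<close> unfolding missing_def by blast
    then show ?thesis using \<open>f \<noteq> e\<close> by simp
  qed
  have "coloring (length ((X - e) # Xs)) (insert e F) ?c"
    unfolding coloring_def
  proof (intro conjI ballI impI)
    fix f assume "f \<in> insert e F"
    then show "?c f < length ((X - e) # Xs)"
      using c unfolding coloring_def by auto
  next
    fix f g assume "f \<in> insert e F" "g \<in> insert e F" "f \<noteq> g \<and> f \<inter> g \<noteq> {}"
    then show "?c f \<noteq> ?c g"
      using new[of f] new[of g] c unfolding coloring_def
      by (cases "f = e"; cases "g = e") (auto simp: Int_commute)
  qed
  moreover have "missing (insert e F) ?c i v" if "i < length ((X - e) # Xs)"
      "v \<in> ((X - e) # Xs) ! i" for i v
    using that m[of i v] unfolding missing_def by (cases i) auto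
  ultimately show ?thesis
    unfolding position_def by blast
qed

text \<open>
  The erased color was present at both ends of \<open>e\<close>, hence not recorded there, and is missing now.\<close>

lemma position_uncolor:
  assumes "position F Xs" "e \<in> F"
  obtains i where "i < length Xs" "Xs ! i \<inter> e = {}" "position (F - {e}) (Xs[i := Xs ! i \<union> e])"
proof -
  obtain c where c: "coloring (length Xs) F c"
    and m: "\<And>i v. i < length Xs \<Longrightarrow> v \<in> Xs ! i \<Longrightarrow> missing F c i v"
    using assms(1) unfolding position_def by blast
  have lt: "c e < length Xs"
    using c assms(2) unfolding coloring_def by blast
  moreover have "Xs ! c e \<inter> e = {}"
    using m[OF lt] assms(2) unfolding missing_def by blast
  moreover have "missing (F - {e}) c i v"
    if "i < length (Xs[c e := Xs ! c e \<union> e])" "v \<in> Xs[c e := Xs ! c e \<union> e] ! i" for i v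
  proof (cases "i = c e \<and> v \<in> e")
    case True
    then show ?thesis
      using c assms(2) unfolding coloring_def missing_def
          by (metis DiffD1 DiffD2 disjoint_iff singletonI)
  next
    case False
    then have "v \<in> Xs ! i"
      using that by (cases "i = c e") auto
    then show ?thesis
      using m[of i v] that unfolding missing_def by auto
  qed
  moreover have "coloring (length (Xs[c e := Xs ! c e \<union> e])) (F - {e}) c"
    using c unfolding coloring_def by auto
  ultimately show thesis
    using that unfolding position_def by blast
qed

text \<open>
  At most as many colors are present at \<open>p\<close> as there are colored edges at \<open>p\<close>.\<close>

lemma position_new_vertex:
  assumes pos: "position F Xs" and fin: "finite F" and deg: "card {e \<in> F. p \<in> e} + j \<le> length Xs"
  obtains A where "A \<subseteq> {..<length Xs}" "card A = j"
    "position F (map (\<lambda>i. if i \<in> A then insert p (Xs ! i) else Xs ! i) [0..<length Xs])"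
proof -
  obtain c where c: "coloring (length Xs) F c"
    and m: "\<And>i v. i < length Xs \<Longrightarrow> v \<in> Xs ! i \<Longrightarrow> missing F c i v"
    using pos unfolding position_def by blast
  have "card (c ` {e \<in> F. p \<in> e}) \<le> card {e \<in> F. p \<in> e}"
    using fin by (simp add: card_image_le)
  then have "j \<le> card ({..<length Xs} - c ` {e \<in> F. p \<in> e})"
    using deg diff_card_le_card_Diff[of "c ` {e \<in> F. p \<in> e}" "{..<length Xs}"] fin by simp
  then obtain A where A: "A \<subseteq> {..<length Xs} - c ` {e \<in> F. p \<in> e}" "card A = j"
    by (meson obtain_subset_with_card_n)
  have "missing F c i p" if "i \<in> A" for i
    using A(1) that unfolding missing_def by blast
  then have "position F (map (\<lambda>i. if i \<in> A then insert p (Xs ! i) else Xs ! i) [0..<length Xs])"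
    unfolding position_def using c m by (intro exI[of _ c]) auto
  then show thesis
    using that[of A] A by blast
qed

section \<open>Positions as Boolean tables\<close>

text \<open>
  A position on the vertices \<open>vs\<close> is written as a list of Boolean columns, one for each color: an
  entry tells whether the color is recorded as missing at the vertex in the same place of \<open>vs\<close>.
  Edges are written as such lists too, true at the two ends. The function \<open>sel\<close> recovers the set
  of vertices.\<close>

fun sel :: "'a list \<Rightarrow> bool list \<Rightarrow> 'a set" where
  "sel (v # vs) (b # bs) = (if b then insert v (sel vs bs) else sel vs bs)"
| "sel _ _ = {}"

fun within :: "bool list \<Rightarrow> bool list \<Rightarrow> bool" where
  "within (x # xs) (y # ys) = ((x \<longrightarrow> y) \<and> within xs ys)"
| "within _ _ = True"

fun disjoint_from :: "bool list \<Rightarrow> bool list \<Rightarrow> bool" where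
  "disjoint_from (x # xs) (y # ys) = (\<not> (x \<and> y) \<and> disjoint_from xs ys)"
| "disjoint_from _ _ = True"

fun join :: "bool list \<Rightarrow> bool list \<Rightarrow> bool list" where
  "join (x # xs) (y # ys) = (x \<or> y) # join xs ys"
| "join _ _ = []"

text \<open>
  The entries of the second list are replaced by those of the third where the first list is true.
  With \<open>x\<close> and \<open>y\<close> exchanged as well, this is a color swap at the marked vertices.\<close>

fun mix :: "bool list \<Rightarrow> bool list \<Rightarrow> bool list \<Rightarrow> bool list" where
  "mix (m # ms) (x # xs) (y # ys) = (if m then y else x) # mix ms xs ys"
| "mix _ _ _ = []"

text \<open>
  The vertices at which exactly one of two colors is recorded, each as a separate unit list. These
  are the possible recorded ends of Kempe chains in the two colors.\<close>

fun differences :: "bool list \<Rightarrow> bool list \<Rightarrow> bool list list" where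
  "differences (x # xs) (y # ys) =
     (let ms = map (Cons False) (differences xs ys)
      in if x = y then ms else (True # map (\<lambda>_. False) xs) # ms)"
| "differences _ _ = []"

fun picks :: "'a list \<Rightarrow> ('a \<times> 'a list) list" where
  "picks [] = []"
| "picks (x # xs) = (x, xs) # map (\<lambda>(y, ys). (y, x # ys)) (picks xs)"

fun colorable :: "bool list list \<Rightarrow> bool list list \<Rightarrow> bool" where
  "colorable [] cs = True"
| "colorable (m # ms) cs =
     list_ex (\<lambda>(A, Bs). within m A \<and> colorable ms (mix m A (map (\<lambda>_. False) A) # Bs)) (picks cs)"

fun same_columns :: "bool list list \<Rightarrow> bool list list \<Rightarrow> bool" where
  "same_columns [] ds = (ds = [])"
| "same_columns (A # cs) ds = (A \<in> set ds \<and> same_columns cs (remove1 A ds))"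

lemma sel_empty [simp]: "sel vs (map (\<lambda>_. False) xs) = {}"
proof (induction vs arbitrary: xs)
  case (Cons v vs)
  then show ?case by (cases xs) auto
qed simp

lemma sel_subset: "sel vs A \<subseteq> set vs"
  by (induction vs A rule: sel.induct) auto

lemma sel_within:
  "\<lbrakk>within m A; length m = length vs; length A = length vs\<rbrakk> \<Longrightarrow> sel vs m \<subseteq> sel vs A"
proof (induction vs arbitrary: m A)
  case (Cons v vs)
  then show ?case
    by (cases m; cases A) (auto split: if_splits)
qed simp

lemma sel_disjoint_from:
  "\<lbrakk>sel vs m \<inter> sel vs A = {}; length m = length vs; length A = length vs\<rbrakk> \<Longrightarrow> disjoint_from m A"
proof (induction vs arbitrary: m A)
  case (Cons v vs)
  then show ?case
    by (cases m; cases A) (auto split: if_splits)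
qed simp

lemma sel_join:
  "\<lbrakk>length m = length vs; length A = length vs\<rbrakk> \<Longrightarrow> sel vs (join m A) = sel vs m \<union> sel vs A"
proof (induction vs arbitrary: m A)
  case (Cons v vs)
  then show ?case
    by (cases m; cases A) auto
qed simp

lemma sel_mix:
  "\<lbrakk>distinct vs; length m = length vs; length A = length vs; length B = length vs\<rbrakk>
   \<Longrightarrow> sel vs (mix m A B) = (sel vs A - sel vs m) \<union> (sel vs B \<inter> sel vs m)"
proof (induction vs arbitrary: m A B)
  case (Cons v vs)
  obtain x ms a as b bs where
    *: "m = x # ms" "A = a # as" "B = b # bs" "length ms = length vs" "length as = length vs"
        "length bs = length vs"
    using Cons.prems(2-4) by (cases m; cases A; cases B) auto
  have "v \<notin> sel vs ms" "v \<notin> sel vs as" "v \<notin> sel vs bs"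
    using Cons.prems(1) sel_subset by fastforce+
  then show ?case
    using Cons.IH[of ms as bs] Cons.prems(1) * by auto
qed simp

lemma length_join [simp]: "length (join A B) = min (length A) (length B)"
  by (induction A B rule: join.induct) auto

lemma length_mix [simp]: "length (mix m A B) = min (length m) (min (length A) (length B))"
  by (induction m A B rule: mix.induct) auto

lemma length_differences: "\<lbrakk>m \<in> set (differences A B); length A = length B\<rbrakk> \<Longrightarrow> length m = length A"
  by (induction A B arbitrary: m rule: differences.induct) (auto simp: Let_def split: if_splits)

lemma sel_differences:
  "\<lbrakk>distinct vs; length A = length vs; length B = length vs\<rbrakk>
   \<Longrightarrow> sel vs ` set (differences A B) = (\<lambda>v. {v}) ` ((sel vs A - sel vs B) \<union> (sel vs B - sel vs A))"
proof (induction vs arbitrary: A B)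
  case (Cons v vs)
  obtain a as b bs where
    *: "A = a # as" "B = b # bs" "length as = length vs" "length bs = length vs"
    using Cons.prems(2,3) by (cases A; cases B) auto
  have v: "v \<notin> sel vs as" "v \<notin> sel vs bs"
    using Cons.prems(1) sel_subset by fastforce+
  have IH: "sel vs ` set (differences as bs) =
      (\<lambda>v. {v}) ` ((sel vs as - sel vs bs) \<union> (sel vs bs - sel vs as))"
    using Cons.IH[of as bs] Cons.prems(1) * by simp
  have "sel (v # vs) ` Cons False ` M = sel vs ` M" for M
    by (simp add: image_image)
  then have "sel (v # vs) ` set (differences A B) =
      (if a = b then {} else {{v}}) \<union> sel vs ` set (differences as bs)"
    by (simp add: * Let_def)
  also have "\<dots> = (\<lambda>v. {v}) ` ((sel (v # vs) A - sel (v # vs) B) \<union> (sel (v # vs) B - sel (v # vs)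
      A))"
    unfolding IH * using v by (auto simp: image_iff)
  finally show ?case .
qed simp

lemma mset_picks: "(y, ys) \<in> set (picks xs) \<Longrightarrow> mset xs = add_mset y (mset ys)"
  by (induction xs arbitrary: y ys) auto

lemma picks_nth: "i < length xs \<Longrightarrow> \<exists>ys. (xs ! i, ys) \<in> set (picks xs)"
proof (induction xs arbitrary: i)
  case (Cons x xs)
  then show ?case
    by (cases i) (force)+
qed simp

lemma mset_same_columns: "same_columns cs ds \<Longrightarrow> mset cs = mset ds"
  by (induction cs ds rule: same_columns.induct) auto

lemma position_reorder:
  assumes "position F (map (sel vs) cs)" "mset cs = mset ds"
  shows "position F (map (sel vs) ds)"
  using position_mset_cong[OF assms(1), of "map (sel vs) ds"] assms(2) by simp

lemma colorable_sound:
  assumes "colorable es cs" "position F (map (sel vs) cs)" "distinct vs"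
    "\<forall>A\<in>set cs. length A = length vs" "\<forall>m\<in>set es. length m = length vs"
  shows "\<exists>c. coloring (length cs) (F \<union> sel vs ` set es) c"
  using assms
proof (induction es arbitrary: cs F)
  case Nil
  then show ?case
    by (auto simp: position_def)
next
  case (Cons m es)
  from Cons.prems(1) obtain A Bs where A: "(A, Bs) \<in> set (picks cs)" "within m A"
    "colorable es (mix m A (map (\<lambda>_. False) A) # Bs)"
    by (auto simp: list_ex_iff)
  have ms: "mset cs = mset (A # Bs)"
    using mset_picks[OF A(1)] by simp
  have len: "length A = length vs" "\<forall>B\<in>set Bs. length B = length vs" "length m = length vs"
    using Cons.prems(4,5) mset_eq_setD[OF ms] by auto
  have "position F (sel vs A # map (sel vs) Bs)"
    using position_reorder[OF Cons.prems(2) ms] by simp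
  then have "position (insert (sel vs m) F) ((sel vs A - sel vs m) # map (sel vs) Bs)"
    by (rule position_color) (use A(2) len in \<open>simp add: sel_within\<close>)
  then have "position (insert (sel vs m) F) (map (sel vs) (mix m A (map (\<lambda>_. False) A) # Bs))"
    using len Cons.prems(3) by (simp add: sel_mix)
  from Cons.IH[OF A(3) this Cons.prems(3)] show ?case
    using len Cons.prems(5) mset_eq_length[OF ms] by simp
qed

section \<open>Strategies of Kempe swaps\<close>

text \<open>
  Evaluation by rewriting simplifies both sides of a disjunction or conjunction. These equations
  with conditionals stop a backtracking search at the first success and cut off its dead ends.\<close>

lemma list_ex_lazy [code]:
  "list_ex P [] = False" "list_ex P (x # xs) = (if P x then True else list_ex P xs)"
  by simp_all

lemma colorable_lazy [code]:
  "colorable [] cs = True"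
  "colorable (m # ms) cs =
     list_ex (\<lambda>(A, Bs). if within m A then colorable ms (mix m A (map (\<lambda>_. False) A) # Bs) else
         False) (picks cs)"
  by (auto simp: list_ex_iff)

text \<open>
  \<open>Chain a b i \<sigma>s\<close> swaps the colors \<open>a\<close> and \<open>b\<close> along the Kempe chain from the vertex number \<open>i\<close>.
  There is one continuation for every vertex at which the chain may end, in the order of the
  vertices; the one for \<open>i\<close> itself is used if there is no other recorded end. A list that is too
  short is to be filled up with \<open>Done\<close>.\<close>

datatype strategy = Done | Chain nat nat nat "strategy list"

text \<open>
  A play ends when the erased edges \<open>es\<close> can be colored from the lists or when the position is one
  of the target positions \<open>ts\<close>, up to names of colors.\<close>

definition settled :: "bool list list \<Rightarrow> bool list list list \<Rightarrow> bool list list \<Rightarrow> bool" where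
  "settled es ts cs = (if list_ex (same_columns cs) ts then True else colorable es cs)"

definition chain_swap :: "nat \<Rightarrow> nat \<Rightarrow> bool list \<Rightarrow> bool list list \<Rightarrow> bool list list" where
  "chain_swap a b m cs = cs[a := mix m (cs ! a) (cs ! b), b := mix m (cs ! b) (cs ! a)]"

fun wins :: "bool list list \<Rightarrow> bool list list list \<Rightarrow> strategy \<Rightarrow> bool list list \<Rightarrow> bool"
  and wins_all :: "bool list list \<Rightarrow> bool list list list \<Rightarrow> strategy list \<Rightarrow> bool list list list \<Rightarrow>
      bool" where
  "wins es ts Done cs = settled es ts cs"
| "wins es ts (Chain a b i \<sigma>s) cs =
     (let ms = differences (cs ! a) (cs ! b); m = map (\<lambda>l. l = i) [0..<length (cs ! a)]
      in a < b \<and> b < length cs \<and> m \<in> set ms \<and>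
         wins_all es ts \<sigma>s (map (\<lambda>m'. chain_swap a b (join m m') cs) ms))"
| "wins_all es ts [] css = list_all (settled es ts) css"
| "wins_all es ts (\<sigma> # \<sigma>s) [] = True"
| "wins_all es ts (\<sigma> # \<sigma>s) (cs # css) = (wins es ts \<sigma> cs \<and> wins_all es ts \<sigma>s css)"

text \<open>
  Some coloring of \<open>F\<close> realizes one of the positions \<open>css\<close> at the vertices \<open>vs\<close>. The alternatives
  in \<open>css\<close> are the possible moves of the opponent.\<close>

definition reaches :: "nat \<Rightarrow> 'a set set \<Rightarrow> 'a list \<Rightarrow> bool list list list \<Rightarrow> bool" where
  "reaches k F vs css \<longleftrightarrow> distinct vs \<and>
     (\<exists>cs\<in>set css. length cs = k \<and> (\<forall>A\<in>set cs. length A = length vs)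
         \<and> position F (map (sel vs) cs))"

lemma reachesE:
  assumes "reaches k F vs css"
  obtains cs where "cs \<in> set css" "reaches k F vs [cs]"
  using assms by (auto simp: reaches_def)

lemma reaches_mono: "\<lbrakk>reaches k F vs css; set css \<subseteq> set dss\<rbrakk> \<Longrightarrow> reaches k F vs dss"
  by (auto simp: reaches_def)

lemma reaches_same_columns:
  assumes "reaches k F vs [cs]" "same_columns cs ds"
  shows "reaches k F vs [ds]"
proof -
  have ms: "mset cs = mset ds"
    using assms(2) by (rule mset_same_columns)
  then show ?thesis
    using assms(1) position_reorder[OF _ ms] mset_eq_length[OF ms] mset_eq_setD[OF ms]
    by (auto simp: reaches_def)
qed

lemma settled_sound:
  assumes "settled es ts cs" "reaches k F vs [cs]" "\<forall>m\<in>set es. length m = length vs"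
  shows "(\<exists>c. coloring k (F \<union> sel vs ` set es) c) \<or> reaches k F vs ts"
proof (cases "list_ex (same_columns cs) ts")
  case True
  then obtain ds where "ds \<in> set ts" "same_columns cs ds"
    by (auto simp: list_ex_iff)
  then show ?thesis
    using reaches_same_columns[OF assms(2)] reaches_mono[of k F vs "[ds]" ts] by auto
next
  case False
  then show ?thesis
    using assms colorable_sound[of es cs F vs] by (auto simp: settled_def reaches_def)
qed

lemma chain_swap_sound:
  assumes "reaches k F vs [cs]" and F: "\<forall>e\<in>F. card e = 2" and ab: "a < b" "b < length cs"
    and m: "m \<in> set (differences (cs ! a) (cs ! b))"
  obtains m' where "m' \<in> set (differences (cs ! a) (cs ! b))"
      "reaches k F vs [chain_swap a b (join m m') cs]"
proof -
  let ?A = "cs ! a" and ?B = "cs ! b"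
  let ?ms = "differences ?A ?B" and ?D = "(sel vs ?A - sel vs ?B) \<union> (sel vs ?B - sel vs ?A)"
  have vs: "distinct vs" and k: "length cs = k" and len: "\<forall>A\<in>set cs. length A = length vs"
    and pos: "position F (map (sel vs) cs)"
    using assms(1) by (auto simp: reaches_def)
  have AB: "length ?A = length vs" "length ?B = length vs"
    using len ab by auto
  have D: "sel vs ` set ?ms = (\<lambda>v. {v}) ` ?D"
    using sel_differences vs AB by blast
  then obtain v where v: "sel vs m = {v}" "v \<in> ?D"
    using m by blast
  have Xs: "map (sel vs) cs ! a = sel vs ?A" "map (sel vs) cs ! b = sel vs ?B"
    using ab by simp_all
  obtain w where w: "w \<in> ?D" "position F ((map (sel vs) cs)
      [a := (sel vs ?A - {v, w}) \<union> (sel vs ?B \<inter> {v, w}), b := (sel vs ?B - {v, w}) \<union> (sel vs ?A \<inter>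
          {v, w})])"
    using position_kempe[OF pos, of a b v] F ab v(2) unfolding Xs by auto
  have "{w} \<in> sel vs ` set ?ms"
    using D w(1) by blast
  then obtain m' where m': "m' \<in> set ?ms" "sel vs m' = {w}"
    by force
  have lm: "length m = length vs" "length m' = length vs"
    using length_differences m m'(1) AB by metis+
  then have "sel vs (join m m') = {v, w}"
    using v(1) m'(2) by (auto simp: sel_join)
  then have "position F (map (sel vs) (chain_swap a b (join m m') cs))"
    using w(2) lm AB vs by (simp add: chain_swap_def map_update sel_mix)
  moreover have "\<forall>A\<in>set (chain_swap a b (join m m') cs). length A = length vs"
  proof -
    have "set (chain_swap a b (join m m') cs) \<subseteq>
        insert (mix (join m m') ?B ?A) (insert (mix (join m m') ?A ?B) (set cs))"
      unfolding chain_swap_def by (meson insert_mono order_trans set_update_subset_insert)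
    then show ?thesis
      using len lm AB by auto
  qed
  ultimately have "reaches k F vs [chain_swap a b (join m m') cs]"
    using vs k by (simp add: reaches_def chain_swap_def)
  then show thesis
    using m'(1) that by blast
qed

text \<open>
  The central fact about the game. No assumption on the graph outside \<open>vs\<close> enters: every way in
  which a chain may end is one of the cases that the strategy has to treat.\<close>

lemma wins_sound:
  assumes F: "\<forall>e\<in>F. card e = 2"
  shows "\<lbrakk>wins es ts \<sigma> cs; reaches k F vs [cs]; \<forall>m\<in>set es. length m = length vs\<rbrakk>
      \<Longrightarrow> (\<exists>c. coloring k (F \<union> sel vs ` set es) c) \<or> reaches k F vs ts"
    and "\<lbrakk>wins_all es ts \<sigma>s css; reaches k F vs css; \<forall>m\<in>set es. length m = length vs\<rbrakk>
      \<Longrightarrow> (\<exists>c. coloring k (F \<union> sel vs ` set es) c) \<or> reaches k F vs ts"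
proof (induction es ts \<sigma> cs and es ts \<sigma>s css rule: wins_wins_all.induct)
  case (1 es ts cs)
  then have "settled es ts cs" by simp
  then show ?case
    using 1(2,3) by (rule settled_sound)
next
  case (2 es ts a b i \<sigma>s cs)
  define ms where "ms = differences (cs ! a) (cs ! b)"
  define m where "m = map (\<lambda>l. l = i) [0..<length (cs ! a)]"
  have *: "a < b" "b < length cs" "m \<in> set ms"
    "wins_all es ts \<sigma>s (map (\<lambda>m'. chain_swap a b (join m m') cs) ms)"
    using 2(2) unfolding ms_def m_def by (auto simp: Let_def)
  obtain m' where "m' \<in> set ms" "reaches k F vs [chain_swap a b (join m m') cs]"
    using chain_swap_sound[OF 2(3) F *(1,2)] *(3) unfolding ms_def by blast
  then have "reaches k F vs (map (\<lambda>m'. chain_swap a b (join m m') cs) ms)"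
    by (elim reaches_mono) auto
  from 2(1)[OF ms_def m_def *(4) this 2(4)] show ?case .
next
  case (3 es ts css)
  then show ?case
  proof -
    obtain cs where cs: "cs \<in> set css" "reaches k F vs [cs]"
      using 3(2) by (rule reachesE)
    then have "settled es ts cs"
      using 3(1) by (simp add: list_all_iff)
    then show ?thesis
      using cs(2) 3(3) by (rule settled_sound)
  qed
next
  case (4 es ts \<sigma> \<sigma>s)
  then show ?case by (simp add: reaches_def)
next
  case (5 es ts \<sigma> \<sigma>s cs css)
  then consider "reaches k F vs [cs]" | "reaches k F vs css"
    by (auto simp: reaches_def)
  then show ?case
  proof cases
    case 1
    then show ?thesis using 5(1)[OF _ 1 5(5)] 5(3) by simp
  next
    case 2
    then show ?thesis using 5(2)[OF _ 2 5(5)] 5(3) by simp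
  qed
qed

fun dedupe :: "bool list list list \<Rightarrow> bool list list list" where
  "dedupe [] = []"
| "dedupe (cs # css) = (if list_ex (same_columns cs) css then dedupe css else cs # dedupe css)"

lemma reaches_dedupe: "reaches k F vs css \<Longrightarrow> reaches k F vs (dedupe css)"
proof (induction css)
  case (Cons cs css)
  then have "reaches k F vs [cs] \<or> reaches k F vs css"
    by (auto simp: reaches_def)
  then show ?case
  proof
    assume cs: "reaches k F vs [cs]"
    show ?case
    proof (cases "list_ex (same_columns cs) css")
      case True
      then obtain ds where "ds \<in> set css" "same_columns cs ds"
        by (auto simp: list_ex_iff)
      then have "reaches k F vs css"
        using reaches_same_columns[OF cs, of ds] reaches_mono[of k F vs "[ds]" css] by simp
      then show ?thesis
        using Cons.IH True by simp
    next
      case False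
      then show ?thesis
        using cs reaches_mono[of k F vs "[cs]" "cs # dedupe css"] by simp
    qed
  next
    assume "reaches k F vs css"
    then show ?case
      using Cons.IH reaches_mono[of k F vs "dedupe css" "cs # dedupe css"] by auto
  qed
qed simp

text \<open>
  All ways to record exactly \<open>j\<close> missing colors at a new first vertex.\<close>

definition add_vertex :: "nat \<Rightarrow> bool list list \<Rightarrow> bool list list list" where
  "add_vertex j cs =
     map (\<lambda>bs. map2 (#) bs cs) (filter (\<lambda>bs. length (filter (\<lambda>b. b) bs) = j) (List.n_lists (length
         cs) [True, False]))"

definition add_vertices :: "nat \<Rightarrow> bool list list list \<Rightarrow> bool list list list" where
  "add_vertices j css = dedupe (concat (map (add_vertex j) css))"

text \<open>
  The opponent chooses the color of the edge \<open>m\<close> that is erased, which cannot be a color recorded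
  as missing at one of its ends.\<close>

definition uncolor :: "bool list \<Rightarrow> bool list list \<Rightarrow> bool list list list" where
  "uncolor m cs = map (\<lambda>(A, Bs). join m A # Bs) (filter (\<lambda>(A, Bs). disjoint_from m A) (picks cs))"

definition uncolor_edge :: "bool list \<Rightarrow> bool list list list \<Rightarrow> bool list list list" where
  "uncolor_edge m css = dedupe (concat (map (uncolor m) css))"

lemma reaches_start: "coloring k F c \<Longrightarrow> reaches k F [] [replicate k []]"
  by (auto simp: reaches_def position_def)

lemma reaches_add_vertices:
  assumes "reaches k F vs css" "finite F" "p \<notin> set vs" "card {e \<in> F. p \<in> e} + j \<le> k"
  shows "reaches k F (p # vs) (add_vertices j css)"
proof -
  obtain cs where cs: "cs \<in> set css" "distinct vs" "length cs = k" "\<forall>A\<in>set cs. length A = length vs"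
    "position F (map (sel vs) cs)"
    using assms(1) by (auto simp: reaches_def)
  obtain A where A: "A \<subseteq> {..<k}" "card A = j"
    "position F (map (\<lambda>i. if i \<in> A then insert p (map (sel vs) cs ! i) else map (sel vs) cs ! i)
        [0..<k])"
    using position_new_vertex[OF cs(5) assms(2), of p j] assms(4) cs(3) by auto
  define bs where "bs = map (\<lambda>i. i \<in> A) [0..<k]"
  have bs: "length bs = k" "length (filter (\<lambda>b. b) bs) = j"
  proof -
    show "length bs = k" by (simp add: bs_def)
    have "length (filter (\<lambda>b. b) bs) = length (filter (\<lambda>i. i \<in> A) [0..<k])"
      by (simp add: bs_def filter_map comp_def)
    also have "\<dots> = card (set (filter (\<lambda>i. i \<in> A) [0..<k]))"
      by (rule distinct_card[symmetric]) simp
    also have "set (filter (\<lambda>i. i \<in> A) [0..<k]) = A"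
      using A(1) by auto
    finally show "length (filter (\<lambda>b. b) bs) = j"
      using A(2) by simp
  qed
  have "map2 (#) bs cs \<in> set (add_vertex j cs)"
    using bs cs(3) by (auto simp: add_vertex_def set_n_lists)
  moreover have "map (sel (p # vs)) (map2 (#) bs cs) =
      map (\<lambda>i. if i \<in> A then insert p (map (sel vs) cs ! i) else map (sel vs) cs ! i) [0..<k]"
    using cs(3) bs(1) by (intro nth_equalityI) (auto simp: bs_def)
  moreover have "\<forall>A\<in>set (map2 (#) bs cs). length A = length (p # vs)"
    using cs(4) by (auto dest!: set_zip_rightD)
  ultimately have "reaches k F (p # vs) (concat (map (add_vertex j) css))"
    unfolding reaches_def using cs bs A(3) assms(3) by (intro conjI bexI[of _
        "map2 (#) bs cs"]) auto
  then show ?thesis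
    unfolding add_vertices_def by (rule reaches_dedupe)
qed

lemma reaches_uncolor_edge:
  assumes "reaches k F vs css" "sel vs m \<in> F" "length m = length vs"
  shows "reaches k (F - {sel vs m}) vs (uncolor_edge m css)"
proof -
  obtain cs where cs: "cs \<in> set css" "distinct vs" "length cs = k" "\<forall>A\<in>set cs. length A = length vs"
    "position F (map (sel vs) cs)"
    using assms(1) by (auto simp: reaches_def)
  obtain i where i: "i < length cs" "sel vs (cs ! i) \<inter> sel vs m = {}"
    "position (F - {sel vs m}) ((map (sel vs) cs)[i := sel vs (cs ! i) \<union> sel vs m])"
    using position_uncolor[OF cs(5) assms(2)] by auto
  have len: "length (cs ! i) = length vs"
    using cs(4) i(1) by simp
  obtain Bs where Bs: "(cs ! i, Bs) \<in> set (picks cs)"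
    using picks_nth[OF i(1)] by blast
  let ?ds = "join m (cs ! i) # Bs"
  have ms: "mset cs = add_mset (cs ! i) (mset Bs)"
    using mset_picks[OF Bs] by simp
  have "position (F - {sel vs m}) (map (sel vs) (cs[i := join m (cs ! i)]))"
    using i(3) len assms(3) by (simp add: map_update sel_join Un_commute)
  moreover have "mset (cs[i := join m (cs ! i)]) = mset ?ds"
    using i(1) ms by (simp add: mset_update)
  ultimately have "position (F - {sel vs m}) (map (sel vs) ?ds)"
    by (rule position_reorder)
  moreover have "disjoint_from m (cs ! i)"
    using i(2) len assms(3) by (intro sel_disjoint_from[of vs]) auto
  then have "?ds \<in> set (uncolor m cs)"
    using Bs by (force simp: uncolor_def)
  moreover have "length ?ds = k"
    using mset_eq_length[of cs "cs ! i # Bs"] ms cs(3) by simp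
  moreover have "\<forall>A\<in>set ?ds. length A = length vs"
    using mset_eq_setD[of cs "cs ! i # Bs"] ms cs(4) len assms(3) by auto
  ultimately have "reaches k (F - {sel vs m}) vs (concat (map (uncolor m) css))"
    unfolding reaches_def using cs(1,2) by (intro conjI bexI[of _ ?ds]) auto
  then show ?thesis
    unfolding uncolor_edge_def by (rule reaches_dedupe)
qed

text \<open>
  The first part sorts the positions that may occur: each is settled or listed in the table. The
  second part plays the strategies of the table.\<close>

definition resolves :: "bool list list \<Rightarrow> bool list list list \<Rightarrow> (bool list list \<times> strategy) list \<Rightarrow>
    bool list list list \<Rightarrow> bool" where
  "resolves es ts tab css \<longleftrightarrow> list_all (settled es (map fst tab @ ts)) css
      \<and> list_all (\<lambda>(cs, \<sigma>). wins es ts \<sigma> cs) tab"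

lemma wins_table_sound:
  assumes "list_all (\<lambda>(cs, \<sigma>). wins es ts \<sigma> cs) tab" "reaches k F vs (map fst tab @ ts)"
    "\<forall>e\<in>F. card e = 2" "\<forall>m\<in>set es. length m = length vs"
  shows "(\<exists>c. coloring k (F \<union> sel vs ` set es) c) \<or> reaches k F vs ts"
proof -
  obtain cs where cs: "cs \<in> set (map fst tab @ ts)" "reaches k F vs [cs]"
    using assms(2) by (rule reachesE)
  then consider "cs \<in> set ts" | \<sigma> where "(cs, \<sigma>) \<in> set tab"
    by auto
  then show ?thesis
  proof cases
    case 1
    then show ?thesis
      using cs(2) reaches_mono[of k F vs "[cs]" ts] by simp
  next
    case 2
    then have "wins es ts \<sigma> cs"
      using assms(1) by (auto simp: list_all_iff)
    then show ?thesis
      using wins_sound(1)[OF assms(3) _ cs(2) assms(4)] by blast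
  qed
qed

lemma resolves_sound:
  assumes "resolves es ts tab css" "reaches k F vs css" "\<forall>e\<in>F. card e = 2"
      "\<forall>m\<in>set es. length m = length vs"
  shows "(\<exists>c. coloring k (F \<union> sel vs ` set es) c) \<or> reaches k F vs ts"
proof -
  obtain cs where cs: "cs \<in> set css" "reaches k F vs [cs]"
    using assms(2) by (rule reachesE)
  have "settled es (map fst tab @ ts) cs" "list_all (\<lambda>(cs, \<sigma>). wins es ts \<sigma> cs) tab"
    using assms(1) cs(1) by (auto simp: resolves_def list_all_iff)
  then show ?thesis
    using settled_sound[OF _ cs(2) assms(4)] wins_table_sound[OF _ _ assms(3,4)] by blast
qed

text \<open>
  If the first two vertices of a configuration play the same role, it suffices to treat positions
  up to their exchange, which keeps the tables short.\<close>

fun mirror :: "'b list \<Rightarrow> 'b list" where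
  "mirror (x # y # zs) = y # x # zs"
| "mirror zs = zs"

lemma mirror_mirror [simp]: "mirror (mirror zs) = zs"
  by (cases zs rule: mirror.cases) auto

lemma length_mirror [simp]: "length (mirror zs) = length zs"
  by (cases zs rule: mirror.cases) auto

lemma sel_mirror: "length A = Suc (Suc (length vs))
    \<Longrightarrow> sel (q # p # vs) (mirror A) = sel (p # q # vs) A"
  by (cases A rule: mirror.cases) auto

lemma reaches_mirror:
  assumes "reaches k F (p # q # vs) css"
  shows "reaches k F (q # p # vs) (map (map mirror) css)"
proof -
  obtain cs where cs: "cs \<in> set css" "distinct (p # q # vs)" "length cs = k"
      "\<forall>A\<in>set cs. length A = length (p # q # vs)"
    "position F (map (sel (p # q # vs)) cs)"
    using assms by (auto simp: reaches_def)
  have eq: "map (sel (q # p # vs)) (map mirror cs) = map (sel (p # q # vs)) cs"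
    using cs(4) by (simp add: sel_mirror)
  show ?thesis
    unfolding reaches_def
  proof (intro conjI bexI[of _ "map mirror cs"])
    show "position F (map (sel (q # p # vs)) (map mirror cs))"
      unfolding eq by (rule cs(5))
  qed (use cs in auto)
qed

definition resolves_mirror :: "bool list list \<Rightarrow> bool list list list \<Rightarrow> (bool list list \<times> strategy)
    list \<Rightarrow> bool list list list \<Rightarrow> bool" where
  "resolves_mirror es ts tab css \<longleftrightarrow>
     (let ts' = ts @ map (map mirror) ts
      in list_all (\<lambda>cs. if settled es (map fst tab @ ts') cs then True else list_ex (same_columns
          (map mirror cs)) (map fst tab)) css \<and>
         list_all (\<lambda>(cs, \<sigma>). wins es ts' \<sigma> cs) tab)"

lemma resolves_mirror_sound:
  assumes res: "resolves_mirror es ts tab css" and css: "reaches k F (p # q # vs) css"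
    and F: "\<forall>e\<in>F. card e = 2" and es: "\<forall>m\<in>set es. length m = Suc (Suc (length vs))"
  obtains x y where "x = p \<and> y = q \<or> x = q \<and> y = p"
    "(\<exists>c. coloring k (F \<union> sel (x # y # vs) ` set es) c) \<or> reaches k F (x # y # vs) ts"
proof -
  let ?ts = "ts @ map (map mirror) ts"
  have tab: "list_all (\<lambda>(cs, \<sigma>). wins es ?ts \<sigma> cs) tab"
    and settle: "\<And>cs. cs \<in> set css \<Longrightarrow>
        settled es (map fst tab @ ?ts) cs \<or> list_ex (same_columns (map mirror cs)) (map fst tab)"
    using res by (auto simp: resolves_mirror_def Let_def list_all_iff split: if_splits)
  have len: "\<forall>m\<in>set es. length m = length (x # y # vs)" for x y
    using es by simp
  obtain cs where cs: "cs \<in> set css" "reaches k F (p # q # vs) [cs]"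
    using css by (rule reachesE)
  have "\<exists>x y. (x = p \<and> y = q \<or> x = q \<and> y = p) \<and>
    ((\<exists>c. coloring k (F \<union> sel (x # y # vs) ` set es) c)
        \<or> reaches k F (x # y # vs) (map fst tab @ ?ts))"
  proof (cases "settled es (map fst tab @ ?ts) cs")
    case True
    then show ?thesis
      using settled_sound[OF _ cs(2) len] by blast
  next
    case False
    then obtain ds where ds: "ds \<in> fst ` set tab" "same_columns (map mirror cs) ds"
      using settle[OF cs(1)] by (auto simp: list_ex_iff)
    have "reaches k F (q # p # vs) [map mirror cs]"
      using reaches_mirror[OF cs(2)] by simp
    then have "reaches k F (q # p # vs) [ds]"
      using ds(2) by (rule reaches_same_columns)
    then have "reaches k F (q # p # vs) (map fst tab @ ?ts)"
      using ds(1) by (elim reaches_mono) auto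
    then show ?thesis by blast
  qed
  then obtain x y where xy: "x = p \<and> y = q \<or> x = q \<and> y = p"
    "(\<exists>c. coloring k (F \<union> sel (x # y # vs) ` set es) c)
        \<or> reaches k F (x # y # vs) (map fst tab @ ?ts)"
    by blast
  then consider "\<exists>c. coloring k (F \<union> sel (x # y # vs) ` set es) c" | "reaches k F (x # y # vs) ?ts"
    using wins_table_sound[OF tab _ F len] by blast
  then show thesis
  proof cases
    case 1
    then show ?thesis using that xy(1) by blast
  next
    case 2
    then have "reaches k F (x # y # vs) ts \<or> reaches k F (x # y # vs) (map (map mirror) ts)"
      by (auto simp: reaches_def)
    then show ?thesis
    proof
      assume "reaches k F (x # y # vs) (map (map mirror) ts)"
      from reaches_mirror[OF this] have "reaches k F (y # x # vs) ts"
        by (simp add: comp_def)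
      then show ?thesis
        using that[of y x] xy(1) by blast
    qed (use that xy(1) in blast)
  qed
qed

section \<open>Local configurations and their strategies\<close>

text \<open>
  In the tables a position is given by rows: for each vertex, the list of its missing colors.\<close>

definition columns :: "nat list list \<Rightarrow> bool list list" where
  "columns Rs = map (\<lambda>i. map (\<lambda>R. i \<in> set R) Rs) [0..<4]"

definition edge :: "nat \<Rightarrow> nat \<Rightarrow> nat \<Rightarrow> bool list" where
  "edge n i j = map (\<lambda>k. k = i \<or> k = j) [0..<n]"

definition table :: "(nat list list \<times> strategy) list \<Rightarrow> (bool list list \<times> strategy) list" where
  "table = map (\<lambda>(Rs, \<sigma>). (columns Rs, \<sigma>))"

text \<open>
  The tables list, up to names of colors and up to the symmetry \<open>mirror\<close> where it is used, the
  initial positions of a configuration that are not settled at once. The vertices are numbered in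
  the order in which the lemmas about critical edge sets list them. Except in the last three
  tables, \<open>r\<close> is a vertex of degree 4 with neighbors \<open>s\<close>, \<open>t\<close> of degree 3 and \<open>u\<close>, \<open>v\<close> of degree
  4; \<open>p\<close>, \<open>q\<close> are the neighbors of degree 3 of \<open>v\<close>; and \<open>x\<close>, \<open>y\<close> are those of \<open>u\<close>. The tables
  \<open>path_table_1\<close>, \<open>path_table_2\<close> and \<open>path_table_12\<close> are for the cases that \<open>u\<close> shares with \<open>v\<close>
  its first, its second or both of its neighbors of degree 3.\<close>

definition fan_table :: "(nat list list \<times> strategy) list" where
  "fan_table =
   [([[0,1],[0,1],[0,1,2,3],[0],[2]], Chain 0 3 0 []),
    ([[0,1],[0,1],[0,1,2,3],[2],[0]], Chain 0 3 0 []),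
    ([[0,1],[0,2],[0,1,2,3],[0],[1]], Chain 0 3 0 []),
    ([[0,1],[0,2],[0,1,2,3],[1],[0]], Chain 0 3 0 [])]"

definition pair_table :: "(nat list list \<times> strategy) list" where
  "pair_table =
   [([[0,1],[0,2],[1,2],[0,1],[0,1,2,3],[2],[0,1,2]], Chain 1 3 2 []),
    ([[0,1],[2,3],[0,2],[0,1],[0,1,2,3],[2],[0,1,2]], Chain 1 3 3 [Done, Done, Done,
        Chain 1 2 5 []]),
    ([[0,1],[2,3],[0,2],[1,2],[0,1,2,3],[0],[0,1,2]], Chain 0 3 5 []),
    ([[0,1],[0,2],[0,1],[0,2],[0,1,2,3],[1],[0,1,2]], Chain 0 3 0 [Chain 2 3 3 [Done, Done, Done,
       Chain 1 2 5 []], Chain 0 3 2 []]),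
    ([[0,1],[2,3],[0,2],[1,2],[0,1,2,3],[0],[0,1,3]], Chain 2 3 2 [Done, Chain 0 2 5 []]),
    ([[0,1],[2,3],[0,2],[0,1],[0,1,2,3],[2],[0,1,3]], Chain 2 3 2 [Done,
        Chain 1 2 3 [Done, Done, Done,
       Chain 1 3 5 []]]),
    ([[0,1],[0,2],[0,1],[1,2],[0,1,2,3],[0],[0,1,2]], Chain 0 3 2 []),
    ([[0,1],[0,2],[1,2],[1,3],[0,1,2,3],[2],[1,2,3]], Chain 0 3 3 [Done, Done, Done,
        Chain 1 3 2 []]),
    ([[0,1],[0,1],[0,2],[0,3],[0,1,2,3],[2],[0,1,3]], Chain 1 3 0 []),
    ([[0,1],[0,2],[0,1],[0,3],[0,1,2,3],[1],[0,1,3]], Chain 0 3 0 [Chain 1 2 5 [], Chain 0 2 2 [],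
       Chain 1 2 5 []]),
    ([[0,1],[0,2],[1,2],[1,3],[0,1,2,3],[2],[0,2,3]], Chain 0 3 0 [Done, Done, Chain 1 3 2 [Done,
       Chain 1 2 5 []]]),
    ([[0,1],[0,2],[1,2],[1,3],[0,1,2,3],[2],[0,1,3]], Chain 0 2 2 [Done, Done,
        Chain 2 3 1 [Chain 0 2 2 []]]),
    ([[0,1],[0,1],[0,2],[2,3],[0,1,2,3],[0],[0,1,3]], Chain 1 3 0 []),
    ([[0,1],[0,2],[0,1],[1,3],[0,1,2,3],[0],[0,1,3]], Chain 2 3 1 [Chain 0 2 2 []]),
    ([[0,1],[0,2],[0,1],[0,3],[0,1,2,3],[1],[1,2,3]], Chain 0 3 1 [Done, Done, Done,
        Chain 0 2 1 []]),
    ([[0,1],[0,2],[0,1],[0,3],[0,1,2,3],[1],[0,2,3]], Chain 0 2 0 [Chain 1 2 2 [Done, Done,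
       Chain 1 3 0 [Chain 1 2 2 []]]]),
    ([[0,1],[0,2],[0,1],[1,3],[0,1,2,3],[0],[0,2,3]], Chain 0 2 0 [Chain 2 3 0 [Done, Done,
       Chain 1 3 2 [Done, Chain 0 1 5 []]]]),
    ([[0,1],[0,1],[0,1],[0,2],[0,1,2,3],[1],[0,1,2]], Chain 0 2 0 [Chain 1 3 2 [],
        Chain 0 3 2 [Done, Done,
       Chain 2 3 0 []], Chain 1 3 2 []]),
    ([[0,1],[0,2],[0,1],[1,3],[0,1,2,3],[0],[1,2,3]], Chain 0 2 2 [Done, Done,
        Chain 0 3 3 [Done, Done,
       Done, Chain 1 3 2 []]]),
    ([[0,1],[0,2],[1,3],[0,2],[0,1,2,3],[1],[1,2,3]], Chain 0 3 1 [Done, Done, Done,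
        Chain 0 2 3 [Done,
       Done, Done, Chain 1 2 5 []]]),
    ([[0,1],[0,1],[2,3],[0,1],[0,1,2,3],[2],[0,1,3]], Chain 0 3 0 []),
    ([[0,1],[0,2],[1,3],[0,2],[0,1,2,3],[1],[0,2,3]], Chain 1 3 0 [Done, Done,
        Chain 1 2 1 [Done, Done,
       Done, Chain 2 3 5 []]]),
    ([[0,1],[0,1],[0,2],[1,3],[0,1,2,3],[0],[0,1,2]], Chain 1 2 0 []),
    ([[0,1],[0,2],[0,3],[1,2],[0,1,2,3],[0],[0,1,3]], Chain 0 3 0 [Done, Chain 0 2 5 []]),
    ([[0,1],[2,3],[0,1],[2,3],[0,1,2,3],[0],[0,1,2]], Chain 0 2 1 [Done, Done, Done, Done,
       Chain 1 2 0 [Done, Done, Done, Chain 1 3 5 []]]),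
    ([[0,1],[0,2],[0,3],[1,2],[0,1,2,3],[0],[1,2,3]], Chain 0 3 0 [])]"

definition path_table :: "(nat list list \<times> strategy) list" where
  "path_table =
   [([[0,1],[2,3],[0,2],[0,1],[2,3],[0,1],[0,1,2,3],[1,2,3],[0,2,3]], Chain 1 3 0 []),
    ([[0,1],[2,3],[0,2],[0,1],[2,3],[0,1],[0,1,2,3],[0,2,3],[0,2,3]], Chain 0 3 0 []),
    ([[0,1],[0,2],[1,3],[1,2],[0,3],[1,2],[0,1,2,3],[1,2,3],[0,1,3]], Chain 0 3 0 []),
    ([[0,1],[0,1],[0,2],[0,3],[1,2],[0,3],[0,1,2,3],[0,1,2],[0,1,2]], Chain 0 2 0 []),
    ([[0,1],[0,2],[0,3],[0,1],[2,3],[0,1],[0,1,2,3],[0,1,3],[0,2,3]], Chain 2 3 1 [Done, Done,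
       Chain 1 2 0 []]),
    ([[0,1],[0,2],[1,3],[1,2],[0,3],[1,2],[0,1,2,3],[0,2,3],[0,1,3]], Chain 0 3 0 [Done,
        Chain 0 2 1 []]),
    ([[0,1],[0,2],[1,3],[1,2],[0,3],[1,2],[0,1,2,3],[0,1,3],[0,1,3]], Chain 0 3 0 [Done,
        Chain 0 1 0 []]),
    ([[0,1],[0,1],[2,3],[0,2],[1,3],[0,2],[0,1,2,3],[0,1,3],[1,2,3]], Chain 1 3 0 [Done,
        Chain 1 2 3 []]),
    ([[0,1],[0,2],[1,3],[0,1],[2,3],[0,1],[0,1,2,3],[0,1,3],[1,2,3]], Chain 2 3 1 [Done, Done,
       Chain 1 2 0 []]),
    ([[0,1],[0,2],[0,3],[0,1],[2,3],[0,1],[0,1,2,3],[1,2,3],[0,2,3]], Chain 0 3 1 [Done,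
        Chain 1 2 0 [],
       Chain 1 2 0 [], Done, Chain 0 2 3 []]),
    ([[0,1],[0,2],[0,3],[0,1],[2,3],[0,1],[0,1,2,3],[0,2,3],[0,2,3]], Chain 0 2 2 [Chain 1 3 7 [],
       Chain 0 3 0 [], Done, Done, Chain 0 3 0 []]),
    ([[0,1],[0,2],[1,3],[0,1],[2,3],[0,1],[0,1,2,3],[0,2,3],[1,2,3]], Chain 0 2 3 [Done, Done, Done,
       Chain 0 3 0 []]),
    ([[0,1],[0,1],[0,2],[0,1],[2,3],[0,1],[0,1,2,3],[0,1,2],[0,2,3]], Chain 0 2 0 []),
    ([[0,1],[0,2],[1,3],[0,1],[2,3],[0,1],[0,1,2,3],[1,2,3],[1,2,3]], Chain 0 2 3 [Done, Done, Done,
       Chain 0 3 7 []])]"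

definition path_table_1 :: "(nat list list \<times> strategy) list" where
  "path_table_1 =
   [([[0,1],[0,2,3],[2,3],[0,1],[2,3],[0,1,2,3],[0,1,2],[0,1,3]], Chain 0 2 2 []),
    ([[0,1],[0,2,3],[0,2],[1,3],[0,2],[0,1,2,3],[0,2,3],[0,1,3]], Chain 2 3 2 []),
    ([[0,1],[0,2,3],[0,2],[1,3],[0,2],[0,1,2,3],[1,2,3],[0,1,3]], Chain 2 3 2 []),
    ([[0,1],[0,2,3],[0,1],[2,3],[0,1],[0,1,2,3],[1,2,3],[0,2,3]], Chain 0 2 2 []),
    ([[0,1],[0,2,3],[0,2],[1,3],[0,2],[0,1,2,3],[0,1,3],[1,2,3]], Chain 0 1 1 []),
    ([[0,1],[0,2,3],[0,1],[2,3],[0,1],[0,1,2,3],[0,2,3],[0,2,3]], Chain 0 2 0 []),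
    ([[0,1],[0,1,2],[0,1],[2,3],[0,1],[0,1,2,3],[0,1,2],[0,2,3]], Chain 0 2 0 [])]"

definition path_table_2 :: "(nat list list \<times> strategy) list" where
  "path_table_2 =
   [([[0,1],[0,2],[0,1,3],[2,3],[0,1],[0,1,2,3],[1,2,3],[0,2,3]], Chain 0 2 0 []),
    ([[0,1],[0,2],[0,1,3],[2,3],[0,1],[0,1,2,3],[0,2,3],[0,2,3]], Chain 0 2 0 [])]"

definition path_table_12 :: "(nat list list \<times> strategy) list" where
  "path_table_12 =
   [([[0,1,2],[0,1,3],[2,3],[0,1],[0,1,2,3],[0,2,3],[1,2,3]], Chain 0 2 1 [])]"

definition overlap_table_s :: "(nat list list \<times> strategy) list" where
  "overlap_table_s =
   [([[0,1],[0,2,3],[0,1],[0,1,2,3],[2],[0,1,3]], Chain 1 3 0 []),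
    ([[0,1],[0,1,2],[0,3],[0,1,2,3],[1],[1,2,3]], Chain 0 2 0 []),
    ([[0,1],[0,1,2],[0,3],[0,1,2,3],[1],[0,2,3]], Chain 1 2 0 []),
    ([[0,1],[0,2,3],[1,2],[0,1,2,3],[0],[0,2,3]], Chain 1 2 0 [Done, Done, Chain 2 3 0 []]),
    ([[0,1],[0,2,3],[1,2],[0,1,2,3],[0],[1,2,3]], Chain 0 3 0 [])]"

definition overlap_table_t :: "(nat list list \<times> strategy) list" where
  "overlap_table_t =
   [([[0,1],[0,2],[0,1,2],[0,1,2,3],[2],[0,1,2]], Chain 2 3 1 [Done, Chain 1 2 0 []]),
    ([[0,1],[0,2],[1,2,3],[0,1,2,3],[0],[0,1,3]], Chain 0 1 1 [Done, Done, Chain 1 3 0 []]),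
    ([[0,1],[0,2],[0,2,3],[0,1,2,3],[2],[0,2,3]], Chain 1 3 0 [Chain 1 2 1 [Done, Chain 2 3 0 []]]),
    ([[0,1],[0,2],[0,2,3],[0,1,2,3],[2],[1,2,3]], Chain 0 1 1 [Done, Chain 0 3 0 [Chain 0 2 1 [Done,
       Chain 2 3 0 []]]]),
    ([[0,1],[0,1],[0,2,3],[0,1,2,3],[1],[1,2,3]], Chain 0 2 0 [Chain 1 2 1 [Done, Done,
        Chain 2 3 0 []]]),
    ([[0,1],[0,2],[0,2,3],[0,1,2,3],[0],[0,1,3]], Chain 0 3 0 []),
    ([[0,1],[0,1],[0,2,3],[0,1,2,3],[1],[0,2,3]], Chain 1 2 0 [Done, Done, Chain 1 3 1 [], Done,
       Chain 1 3 1 [Chain 1 2 0 [Done, Chain 2 3 1 []]]]),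
    ([[0,1],[0,1],[0,1,2],[0,1,2,3],[0],[0,1,2]], Chain 0 3 1 [Done, Done, Done, Done,
        Chain 0 2 0 []]),
    ([[0,1],[2,3],[0,1,2],[0,1,2,3],[2],[0,2,3]], Chain 1 3 0 [Done, Done, Chain 1 2 1 [Done,
       Chain 0 2 0 []]]),
    ([[0,1],[0,2],[0,1,3],[0,1,2,3],[0],[0,1,2]], Chain 1 2 0 [])]"

definition low_degree_table :: "(nat list list \<times> strategy) list" where
  "low_degree_table =
   [([[0,1,2],[0,1],[0,1,2,3],[0],[2]], Chain 0 3 0 []),
    ([[0,1,2],[0,1],[0,1,2,3],[2],[0]], Chain 0 3 0 [])]"

definition three_low_table :: "(nat list list \<times> strategy) list" where
  "three_low_table =
   [([[0,1],[0,1],[2,3],[0,1,2,3],[0]], Chain 0 2 0 []),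
    ([[0,1],[2,3],[0,1],[0,1,2,3],[0]], Chain 0 2 0 []),
    ([[0,1],[0,1],[0,2],[0,1,2,3],[0]], Chain 0 3 0 []),
    ([[0,1],[0,2],[0,1],[0,1,2,3],[0]], Chain 0 3 0 []),
    ([[0,1],[0,2],[1,2],[0,1,2,3],[2]], Chain 2 3 1 []),
    ([[0,1],[0,1],[0,1],[0,1,2,3],[2]], Chain 0 3 0 []),
    ([[0,1],[0,1],[0,2],[0,1,2,3],[1]], Chain 1 3 0 []),
    ([[0,1],[0,2],[0,1],[0,1,2,3],[1]], Chain 1 3 0 []),
    ([[0,1],[0,2],[0,1],[0,1,2,3],[2]], Chain 0 3 0 []),
    ([[0,1],[0,2],[0,2],[0,1,2,3],[1]], Chain 0 3 0 []),
    ([[0,1],[0,2],[1,2],[0,1,2,3],[1]], Chain 1 3 0 []),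
    ([[0,1],[0,1],[0,2],[0,1,2,3],[2]], Chain 0 3 0 []),
    ([[0,1],[0,2],[1,2],[0,1,2,3],[0]], Chain 0 3 0 [])]"

definition cubic_table :: "(nat list list \<times> strategy) list" where
  "cubic_table =
   [([[0,1],[0,1],[0,1],[0,1,2,3]], Chain 0 2 0 [])]"

text \<open>
  The two normal forms for the edges at \<open>r\<close>, on the vertices \<open>s, t, r, u, v\<close>. Give the edges \<open>ru\<close>
  and \<open>rv\<close> the only color that is recorded at \<open>u\<close> and \<open>v\<close>. In the first form Vizing's fan at \<open>r\<close>,
  begun with the edge \<open>rs\<close>, extends over \<open>rt\<close>; in the second form it covers only \<open>rs\<close>, \<open>ru\<close> and
  \<open>rv\<close>.\<close>

definition fan_positions :: "bool list list list" where
  "fan_positions = map columns [[[2,3],[0,2],[0,1,2,3],[3],[0]], [[2,3],[0,1],[0,1,2,3],[2],[3]]]"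

text \<open>
  The single position on \<open>p, q, s, t, r, u, v\<close> into which the edges at adjacent vertices \<open>r\<close>, \<open>v\<close>
  of degree 4 are forced if \<open>r\<close> and \<open>v\<close> have no common neighbor of degree 3.\<close>

definition pair_position :: "bool list list" where
  "pair_position = columns [[0,2],[2,3],[0,1],[2,3],[0,1,2,3],[0],[0,1,2]]"

definition fan_edges :: "bool list list" where
    "fan_edges = [edge 5 0 2, edge 5 1 2, edge 5 2 3, edge 5 2 4]"
definition pair_edges :: "nat \<Rightarrow> nat \<Rightarrow> bool list list" where
  "pair_edges n i = map (\<lambda>(a, b). edge n (i + a) (i + b)) [(0,6),(1,6),(2,4),(3,4),(4,5),(4,6)]"

text \<open>
  The remaining lemmas of this section are pure computations. The numbers after \<open>add_vertices\<close> are
  the numbers of missing colors before any of the edges after \<open>uncolor_edge\<close> is erased: four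
  colors, less the degree, plus one at the ends of the first erased edge.\<close>

lemma fan_resolves:
  "resolves_mirror fan_edges fan_positions (table fan_table)
     (foldr uncolor_edge [edge 5 1 2, edge 5 2 3, edge 5 2 4]
        (foldr add_vertices [2, 1, 1, 0, 0] [replicate 4 []]))"
  by code_simp

lemma pair_resolves:
  "resolves_mirror (pair_edges 7 0) [pair_position] (table pair_table)
     (foldr uncolor_edge [edge 7 0 6, edge 7 1 6]
        (foldr add_vertices [1, 1] fan_positions))"
  by code_simp

lemma path_resolves:
  "resolves_mirror (edge 9 0 7 # edge 9 1 7 # pair_edges 9 2) [] (table path_table)
     (foldr uncolor_edge [edge 9 0 7, edge 9 1 7]
        (foldr add_vertices [1, 1] [pair_position]))"
  by code_simp

lemma path_1_resolves:
  "resolves (edge 8 0 6 # edge 8 1 6 # pair_edges 8 1) [] (table path_table_1)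
     (foldr uncolor_edge [edge 8 0 6, edge 8 1 6]
        (foldr add_vertices [1] [pair_position]))"
  by code_simp

lemma path_2_resolves:
  "resolves (edge 8 0 6 # edge 8 2 6 # pair_edges 8 1) [] (table path_table_2)
     (foldr uncolor_edge [edge 8 0 6, edge 8 2 6]
        (foldr add_vertices [1] [pair_position]))"
  by code_simp

lemma path_12_resolves:
  "resolves (edge 7 0 5 # edge 7 1 5 # pair_edges 7 0) [] (table path_table_12)
     (foldr uncolor_edge [edge 7 0 5, edge 7 1 5]
        [pair_position])"
  by code_simp

lemma same_lows_resolves:
  "resolves (edge 7 2 5 # edge 7 3 5 # pair_edges 7 0) [] []
     (foldr uncolor_edge [edge 7 2 5, edge 7 3 5]
        [pair_position])"
  by code_simp

lemma overlap_s_resolves: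
  "resolves [edge 6 0 5, edge 6 1 5, edge 6 1 3, edge 6 2 3, edge 6 3 4, edge 6 3 5] [] (table
      overlap_table_s)
     (foldr uncolor_edge [edge 6 0 5, edge 6 1 5]
        (foldr add_vertices [1] fan_positions))"
  by code_simp

lemma overlap_t_resolves:
  "resolves [edge 6 0 5, edge 6 2 5, edge 6 1 3, edge 6 2 3, edge 6 3 4, edge 6 3 5] [] (table
      overlap_table_t)
     (foldr uncolor_edge [edge 6 0 5, edge 6 2 5]
        (foldr add_vertices [1] fan_positions))"
  by code_simp

lemma low_degree_resolves:
  "resolves fan_edges [] (table low_degree_table)
     (foldr uncolor_edge [edge 5 1 2, edge 5 2 3, edge 5 2 4]
        (foldr add_vertices [3, 1, 1, 0, 0] [replicate 4 []]))"
  by code_simp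

lemma three_low_resolves:
  "resolves [edge 5 0 3, edge 5 1 3, edge 5 2 3, edge 5 3 4] [] (table three_low_table)
     (foldr uncolor_edge [edge 5 1 3, edge 5 2 3, edge 5 3 4]
        (foldr add_vertices [2, 1, 1, 1, 0] [replicate 4 []]))"
  by code_simp

lemma cubic_3_resolves:
  "resolves [edge 4 0 3, edge 4 1 3, edge 4 2 3] [] (table cubic_table)
     (foldr uncolor_edge [edge 4 1 3, edge 4 2 3]
        (foldr add_vertices [2, 1, 1, 2] [replicate 4 []]))"
  by code_simp

lemma cubic_2_resolves:
  "resolves [edge 3 0 2, edge 3 1 2] [] []
     (foldr uncolor_edge [edge 3 1 2]
        (foldr add_vertices [2, 1, 3] [replicate 4 []]))"
  by code_simp

lemma cubic_1_resolves:
  "resolves [edge 2 0 1] [] []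
     (foldr add_vertices [2, 4] [replicate 4 []])"
  by code_simp

section \<open>Local structure of critical edge sets\<close>

locale critical =
  fixes E :: "'a set set"
  assumes finite_edges: "finite E"
    and card_edge: "e \<in> E \<Longrightarrow> card e = 2"
    and not_colorable: "\<not> coloring 4 E c"
    and colorable_minus: "e \<in> E \<Longrightarrow> \<exists>c. coloring 4 (E - {e}) c"
begin

definition deg :: "'a \<Rightarrow> nat" where
  "deg v = card {e \<in> E. v \<in> e}"

lemma deg_subset: "F \<subseteq> E \<Longrightarrow> card {e \<in> F. v \<in> e} \<le> deg v"
  unfolding deg_def using finite_edges by (intro card_mono) auto

lemma deg_minus: "\<lbrakk>e \<in> E; v \<in> e\<rbrakk> \<Longrightarrow> card {f \<in> E - {e}. v \<in> f} = deg v - 1"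
proof -
  assume "e \<in> E" "v \<in> e"
  moreover have "{f \<in> E - {e}. v \<in> f} = {f \<in> E. v \<in> f} - {e}" by auto
  ultimately show ?thesis
    unfolding deg_def using finite_edges by (simp add: card_Diff_singleton)
qed

lemma edge_neq: "{x, y} \<in> E \<Longrightarrow> x \<noteq> y"
  using card_edge by fastforce

lemma reaches_minus_edge:
  assumes "e \<in> E"
  shows "reaches 4 (E - {e}) [] [replicate 4 []]"
  using colorable_minus[OF assms] reaches_start by blast

lemma reaches_add_list:
  assumes "reaches 4 F vs css" "F \<subseteq> E" "distinct (ps @ vs)"
    "list_all2 (\<lambda>p j. card {e \<in> F. p \<in> e} + j \<le> 4) ps js"
  shows "reaches 4 F (ps @ vs) (foldr add_vertices js css)"
  using assms(4,3)
proof (induction ps js rule: list_all2_induct)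
  case Nil
  then show ?case using assms(1) by simp
next
  case (Cons p ps j js)
  then show ?case
    using reaches_add_vertices[of 4 F "ps @ vs" "foldr add_vertices js css" p j]
      finite_subset[OF assms(2) finite_edges] by simp
qed

lemma reaches_uncolor_list:
  assumes "reaches 4 F vs css" "sel vs ` set ms = D" "D \<subseteq> F" "distinct (map (sel vs) ms)"
    "\<forall>m\<in>set ms. length m = length vs"
  shows "reaches 4 (F - D) vs (foldr uncolor_edge ms css)"
  using assms(2-)
proof (induction ms arbitrary: D)
  case Nil
  then show ?case using assms(1) by simp
next
  case (Cons m ms)
  then have "reaches 4 (F - sel vs ` set ms) vs (foldr uncolor_edge ms css)"
    by auto
  then have "reaches 4 (F - sel vs ` set ms - {sel vs m}) vs (uncolor_edge m
      (foldr uncolor_edge ms css))"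
    using Cons.prems by (intro reaches_uncolor_edge) auto
  moreover have "F - sel vs ` set ms - {sel vs m} = F - D"
    using Cons.prems(1) by auto
  ultimately show ?case by simp
qed

text \<open>
  A coloring of \<open>E\<close> does not exist, so only the target positions remain.\<close>

lemma resolve:
  assumes "resolves es ts tab css" "reaches 4 (E - D) vs css" "sel vs ` set es = D" "D \<subseteq> E"
    "\<forall>m\<in>set es. length m = length vs"
  shows "reaches 4 (E - D) vs ts"
proof -
  have "E - D \<union> sel vs ` set es = E" "\<forall>e\<in>E - D. card e = 2"
    using assms(3,4) card_edge by auto
  then show ?thesis
    using resolves_sound[OF assms(1,2) _ assms(5)] not_colorable by auto
qed

lemma resolve_mirror:
  assumes "resolves_mirror es ts tab css" "reaches 4 (E - D) (p # q # vs) css"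
    "sel (p # q # vs) ` set es = D" "sel (q # p # vs) ` set es = D" "D \<subseteq> E"
    "\<forall>m\<in>set es. length m = Suc (Suc (length vs))"
  obtains x y where "x = p \<and> y = q \<or> x = q \<and> y = p" "reaches 4 (E - D) (x # y # vs) ts"
proof -
  have F: "\<forall>e\<in>E - D. card e = 2" using card_edge by auto
  obtain x y where xy: "x = p \<and> y = q \<or> x = q \<and> y = p"
    "(\<exists>c. coloring 4 (E - D \<union> sel (x # y # vs) ` set es) c) \<or> reaches 4 (E - D) (x # y # vs) ts"
    using resolves_mirror_sound[OF assms(1,2) F assms(6)] by blast
  then have "sel (x # y # vs) ` set es = D"
    using assms(3,4) by blast
  then have "E - D \<union> sel (x # y # vs) ` set es = E"
    using assms(5) by blast
  then show thesis
    using that xy not_colorable by auto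
qed

lemma not_reaches_empty [simp]: "\<not> reaches 4 F vs []"
  by (simp add: reaches_def)

lemma resolve_mirror_none:
  assumes "resolves_mirror es [] tab css" "reaches 4 (E - D) (p # q # vs) css"
    "sel (p # q # vs) ` set es = D" "sel (q # p # vs) ` set es = D" "D \<subseteq> E"
    "\<forall>m\<in>set es. length m = Suc (Suc (length vs))"
  shows False
  by (rule resolve_mirror[OF assms]) simp

text \<open>
  The opening move: \<open>E - {e}\<close> is colored, so the two ends of \<open>e\<close> have one more missing color than
  their degrees grant.\<close>

lemma reaches_start_list:
  assumes "e \<in> E" "distinct ps"
    "list_all2 (\<lambda>p j. if p \<in> e then deg p + j \<le> 5 else deg p + j \<le> 4) ps js"
  shows "reaches 4 (E - {e}) ps (foldr add_vertices js [replicate 4 []])"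
proof -
  have "card {f \<in> E - {e}. p \<in> f} + j \<le> 4"
    if "if p \<in> e then deg p + j \<le> 5 else deg p + j \<le> 4" for p j
  proof (cases "p \<in> e")
    case True
    then have "deg p \<noteq> 0"
      using assms(1) finite_edges unfolding deg_def by auto
    then show ?thesis
      using that deg_minus[OF assms(1) True] True by simp
  next
    case False
    then show ?thesis
      using that deg_subset[of "E - {e}" p] by auto
  qed
  then have "list_all2 (\<lambda>p j. card {f \<in> E - {e}. p \<in> f} + j \<le> 4) ps js"
    using assms(3) by (auto elim: list_all2_mono)
  then show ?thesis
    using reaches_add_list[OF reaches_minus_edge[OF assms(1)], of ps js] assms(2) by auto
qed

lemma reaches_add_low:
  assumes "reaches 4 (E - D) vs css" "distinct (ps @ vs)" "\<forall>p\<in>set ps. deg p \<le> 3"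
      "length js = length ps"
    "\<forall>j\<in>set js. j = 1"
  shows "reaches 4 (E - D) (ps @ vs) (foldr add_vertices js css)"
proof (rule reaches_add_list[OF assms(1) _ assms(2)])
  have "card {e \<in> E - D. p \<in> e} \<le> 3" if "p \<in> set ps" for p
    using that assms(3) deg_subset[of "E - D" p] by fastforce
  moreover have "js ! i = 1" if "i < length ps" for i
    using assms(4,5) that by (metis nth_mem)
  ultimately show "list_all2 (\<lambda>p j. card {e \<in> E - D. p \<in> e} + j \<le> 4) ps js"
    using assms(4) by (force simp: list_all2_conv_all_nth)
qed auto

lemmas mask_simps = edge_def upt_rec fan_edges_def pair_edges_def insert_commute

definition nbrs :: "'a \<Rightarrow> 'a set" where
  "nbrs x = {y. {x, y} \<in> E}"

lemma nbrs_sym: "y \<in> nbrs x \<longleftrightarrow> x \<in> nbrs y"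
  by (simp add: nbrs_def insert_commute)

lemma not_self_nbr: "x \<notin> nbrs x"
  using edge_neq[of x x] by (auto simp: nbrs_def)

lemma edges_at: "{e \<in> E. x \<in> e} = (\<lambda>y. {x, y}) ` nbrs x"
proof -
  have "e \<in> (\<lambda>y. {x, y}) ` nbrs x" if "e \<in> E" "x \<in> e" for e
  proof -
    obtain y where "e = {x, y}"
      using card_edge[OF \<open>e \<in> E\<close>] \<open>x \<in> e\<close> by (metis card_2_iff doubleton_eq_iff insert_iff
          singletonD)
    then show ?thesis
      using that by (auto simp: nbrs_def)
  qed
  then show ?thesis
    by (auto simp: nbrs_def)
qed

lemma inj_on_edge: "inj_on (\<lambda>y. {x, y}) A"
  by (auto simp: inj_on_def doubleton_eq_iff)

lemma card_nbrs: "card (nbrs x) = deg x"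
  unfolding deg_def edges_at by (simp add: card_image inj_on_edge)

lemma finite_nbrs: "finite (nbrs x)"
proof -
  have "finite ((\<lambda>y. {x, y}) ` nbrs x)"
    unfolding edges_at[symmetric] using finite_edges by simp
  then show ?thesis
    using inj_on_edge by (rule finite_imageD)
qed

text \<open>
  This and the next lemma replace Vizing's adjacency lemma at a vertex of degree 4: if one
  neighbor has degree at most 2, then the other three have degree 4, and in any case at most two
  neighbors have degree less than 4.\<close>

lemma no_degree_2_neighbor:
  assumes "{x, y} \<in> E" "{x, z} \<in> E" "{x, u} \<in> E" "{x, v} \<in> E" and dist: "distinct [y, z, x, u, v]"
    and deg: "deg x \<le> 4" "deg y \<le> 2" "deg z \<le> 3" "deg u \<le> 4" "deg v \<le> 4"
  shows False
proof -
  let ?css = "foldr add_vertices [3,1,1,0,0] [replicate 4 []]"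
  have "reaches 4 (E - {{x, y}}) [y, z, x, u, v] ?css"
    using assms by (intro reaches_start_list) auto
  then have "reaches 4 (E - {{x, y}} - {{x, z}, {x, u}, {x, v}}) [y, z, x, u, v]
     (foldr uncolor_edge [edge 5 1 2, edge 5 2 3, edge 5 2 4] ?css)"
    by (rule reaches_uncolor_list) (use assms in \<open>auto simp: mask_simps doubleton_eq_iff\<close>)
  moreover have "E - {{x, y}} - {{x, z}, {x, u}, {x, v}} = E - {{x, y}, {x, z}, {x, u}, {x, v}}"
    by auto
  ultimately have "reaches 4 (E - {{x, y}, {x, z}, {x, u}, {x, v}}) [y, z, x, u, v] []"
    by (intro resolve[OF low_degree_resolves]) (use assms in \<open>simp_all add: mask_simps\<close>)
  then show False by simp
qed

lemma no_three_low_neighbors: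
  assumes "{x, y1} \<in> E" "{x, y2} \<in> E" "{x, y3} \<in> E" "{x, u} \<in> E" and dist:
      "distinct [y1, y2, y3, x, u]"
    and deg: "deg x \<le> 4" "deg y1 \<le> 3" "deg y2 \<le> 3" "deg y3 \<le> 3" "deg u \<le> 4"
  shows False
proof -
  let ?css = "foldr add_vertices [2,1,1,1,0] [replicate 4 []]"
  have "reaches 4 (E - {{x, y1}}) [y1, y2, y3, x, u] ?css"
    using assms by (intro reaches_start_list) auto
  then have "reaches 4 (E - {{x, y1}} - {{x, y2}, {x, y3}, {x, u}}) [y1, y2, y3, x, u]
     (foldr uncolor_edge [edge 5 1 3, edge 5 2 3, edge 5 3 4] ?css)"
    by (rule reaches_uncolor_list) (use assms in \<open>auto simp: mask_simps doubleton_eq_iff\<close>)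
  moreover have "E - {{x, y1}} - {{x, y2}, {x, y3}, {x, u}} = E - {{x, y1}, {x, y2}, {x, y3}, {x,
      u}}"
    by auto
  ultimately have "reaches 4 (E - {{x, y1}, {x, y2}, {x, y3}, {x, u}}) [y1, y2, y3, x, u] []"
    by (intro resolve[OF three_low_resolves]) (use assms in \<open>simp_all add: mask_simps\<close>)
  then show False by simp
qed

lemma fan_normal_form:
  assumes "{r, s} \<in> E" "{r, t} \<in> E" "{r, u} \<in> E" "{r, v} \<in> E" and dist: "distinct [s, t, r, u, v]"
    and deg: "deg r \<le> 4" "deg s \<le> 3" "deg t \<le> 3" "deg u \<le> 4" "deg v \<le> 4"
  obtains s' t' where "s' = s \<and> t' = t \<or> s' = t \<and> t' = s"
    "reaches 4 (E - {{r, s}, {r, t}, {r, u}, {r, v}}) [s', t', r, u, v] fan_positions"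
proof -
  let ?css = "foldr add_vertices [2,1,1,0,0] [replicate 4 []]"
  have "reaches 4 (E - {{r, s}}) [s, t, r, u, v] ?css"
    using assms by (intro reaches_start_list) auto
  then have "reaches 4 (E - {{r, s}} - {{r, t}, {r, u}, {r, v}}) [s, t, r, u, v]
     (foldr uncolor_edge [edge 5 1 2, edge 5 2 3, edge 5 2 4] ?css)"
    by (rule reaches_uncolor_list) (use assms in \<open>auto simp: mask_simps doubleton_eq_iff\<close>)
  moreover have "E - {{r, s}} - {{r, t}, {r, u}, {r, v}} = E - {{r, s}, {r, t}, {r, u}, {r, v}}"
    by auto
  ultimately show thesis
    using assms that by (elim resolve_mirror[OF fan_resolves, rotated -1]) (simp_all add:
        mask_simps)
qed

lemma pair_normal_form:
  assumes "{r, s} \<in> E" "{r, t} \<in> E" "{r, u} \<in> E" "{r, v} \<in> E" "{v, p} \<in> E" "{v, q} \<in> E"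
    and dist: "distinct [p, q, s, t, r, u, v]"
    and deg: "deg r \<le> 4" "deg s \<le> 3" "deg t \<le> 3" "deg u \<le> 4" "deg v \<le> 4" "deg p \<le> 3" "deg q \<le> 3"
  obtains s' t' p' q' where "s' = s \<and> t' = t \<or> s' = t \<and> t' = s" "p' = p \<and> q' = q \<or> p' = q \<and> q' = p"
    "reaches 4 (E - {{r, s'}, {r, t'}, {r, u}, {r, v}, {v, p'}, {v, q'}}) [p', q', s', t', r, u, v]
        [pair_position]"
proof -
  obtain s' t' where st: "s' = s \<and> t' = t \<or> s' = t \<and> t' = s"
    and reach: "reaches 4 (E - {{r, s}, {r, t}, {r, u}, {r, v}}) [s', t', r, u, v] fan_positions"
    using fan_normal_form[of r s t u v] assms by auto
  have D4: "{{r, s}, {r, t}, {r, u}, {r, v}} = {{r, s'}, {r, t'}, {r, u}, {r, v}}"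
    using st by auto
  have facts: "{r, s'} \<in> E" "{r, t'} \<in> E" "distinct [p, q, s', t', r, u, v]"
    using st assms by auto
  let ?D = "{{r, s'}, {r, t'}, {r, u}, {r, v}, {v, p}, {v, q}}"
  have "reaches 4 (E - {{r, s'}, {r, t'}, {r, u}, {r, v}}) ([p, q] @ [s', t', r, u, v])
      (foldr add_vertices [1,1] fan_positions)"
    by (rule reaches_add_low[OF reach[unfolded D4]]) (use facts deg in auto)
  then have "reaches 4 (E - {{r, s'}, {r, t'}, {r, u}, {r, v}} - {{v, p}, {v, q}}) ([p, q] @ [s',
      t', r, u, v])
    (foldr uncolor_edge [edge 7 0 6, edge 7 1 6] (foldr add_vertices [1,1] fan_positions))"
    by (rule reaches_uncolor_list) (use assms facts in \<open>auto simp: mask_simps doubleton_eq_iff\<close>)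
  moreover have "E - {{r, s'}, {r, t'}, {r, u}, {r, v}} - {{v, p}, {v, q}} = E - ?D"
    by auto
  ultimately have "reaches 4 (E - ?D) (p # q # [s', t', r, u, v])
    (foldr uncolor_edge [edge 7 0 6, edge 7 1 6] (foldr add_vertices [1,1] fan_positions))"
    by simp
  then obtain p' q' where pq: "p' = p \<and> q' = q \<or> p' = q \<and> q' = p"
    "reaches 4 (E - ?D) (p' # q' # [s', t', r, u, v]) [pair_position]"
    using assms facts by (elim resolve_mirror[OF pair_resolves, rotated -1]) (simp_all add:
        mask_simps)
  moreover have "?D = {{r, s'}, {r, t'}, {r, u}, {r, v}, {v, p'}, {v, q'}}"
    using pq(1) by auto
  ultimately show thesis
    using that[OF st pq(1)] by simp
qed

lemma no_single_shared_neighbor: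
  assumes "{r, s} \<in> E" "{r, t} \<in> E" "{r, u} \<in> E" "{r, v} \<in> E" "{v, s} \<in> E" "{v, p} \<in> E"
    and dist: "distinct [p, s, t, r, u, v]"
    and deg: "deg r \<le> 4" "deg s \<le> 3" "deg t \<le> 3" "deg u \<le> 4" "deg v \<le> 4" "deg p \<le> 3"
  shows False
proof -
  obtain s' t' where st: "s' = s \<and> t' = t \<or> s' = t \<and> t' = s"
    and reach: "reaches 4 (E - {{r, s}, {r, t}, {r, u}, {r, v}}) [s', t', r, u, v] fan_positions"
    using fan_normal_form[of r s t u v] assms by auto
  let ?D = "{{r, s}, {r, t}, {r, u}, {r, v}}"
  let ?css = "foldr add_vertices [1] fan_positions"
  have "distinct [p, s', t', r, u, v]" "deg p \<le> 3"
    using st assms by auto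
  then have 1: "reaches 4 (E - ?D) ([p] @ [s', t', r, u, v]) ?css"
    by (intro reaches_add_low[OF reach]) auto
  have D: "E - ?D - {{v, p}, {v, s}} = E - {{v, p}, {v, s}, {r, s}, {r, t}, {r, u}, {r, v}}"
    by auto
  from st show False
  proof
    assume "s' = s \<and> t' = t"
    with 1 have "reaches 4 (E - ?D) [p, s, t, r, u, v] ?css" by simp
    then have "reaches 4 (E - ?D - {{v, p}, {v, s}}) [p, s, t, r, u, v]
        (foldr uncolor_edge [edge 6 0 5, edge 6 1 5] ?css)"
      by (rule reaches_uncolor_list) (use assms in \<open>auto simp: mask_simps doubleton_eq_iff\<close>)
    then have "reaches 4 (E - {{v, p}, {v, s}, {r, s}, {r, t}, {r, u}, {r, v}}) [p, s, t, r, u, v]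
        []"
      unfolding D by (rule resolve[OF overlap_s_resolves]) (use assms in \<open>simp_all add: mask_simps\<close>)
    then show False by simp
  next
    assume "s' = t \<and> t' = s"
    with 1 have "reaches 4 (E - ?D) [p, t, s, r, u, v] ?css" by simp
    then have "reaches 4 (E - ?D - {{v, p}, {v, s}}) [p, t, s, r, u, v]
        (foldr uncolor_edge [edge 6 0 5, edge 6 2 5] ?css)"
      by (rule reaches_uncolor_list) (use assms in \<open>auto simp: mask_simps doubleton_eq_iff\<close>)
    then have "reaches 4 (E - {{v, p}, {v, s}, {r, s}, {r, t}, {r, u}, {r, v}}) [p, t, s, r, u, v]
        []"
      unfolding D by (rule resolve[OF overlap_t_resolves]) (use assms in \<open>simp_all add: mask_simps\<close>)
    then show False by simp
  qed
qed

text \<open>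
  The generic case of a path \<open>u\<close>, \<open>r\<close>, \<open>v\<close> of vertices of degree 4, in which the six neighbors of
  degree 3 are distinct. The two lemmas that follow treat the coincidences among them that
  \<open>no_single_shared_neighbor\<close> leaves open.\<close>

lemma no_disjoint_low_neighbors:
  assumes "{r, s} \<in> E" "{r, t} \<in> E" "{r, u} \<in> E" "{r, v} \<in> E" "{v, p} \<in> E" "{v, q} \<in> E"
      "{u, x} \<in> E" "{u, y} \<in> E"
    and dist: "distinct [x, y, p, q, s, t, r, u, v]"
    and deg: "deg r \<le> 4" "deg s \<le> 3" "deg t \<le> 3" "deg u \<le> 4" "deg v \<le> 4" "deg p \<le> 3" "deg q \<le> 3"
      "deg x \<le> 3" "deg y \<le> 3"
  shows False
proof -
  obtain s' t' p' q' where st: "s' = s \<and> t' = t \<or> s' = t \<and> t' = s" and pq: "p' = p \<and> q' = q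
      \<or> p' = q \<and> q' = p"
    and reach: "reaches 4 (E - {{r, s'}, {r, t'}, {r, u}, {r, v}, {v, p'}, {v, q'}}) [p', q', s',
        t', r, u, v] [pair_position]"
    by (rule pair_normal_form[OF assms(1-6) _ deg(1-7)]) (use dist in \<open>simp\<close>, erule (2) that)
  let ?D = "{{r, s'}, {r, t'}, {r, u}, {r, v}, {v, p'}, {v, q'}}"
  let ?D' = "{{u, x}, {u, y}, {r, s'}, {r, t'}, {r, u}, {r, v}, {v, p'}, {v, q'}}"
  let ?css = "foldr add_vertices [1,1] [pair_position]"
  have facts: "{r, s'} \<in> E" "{r, t'} \<in> E" "{v, p'} \<in> E" "{v, q'} \<in> E"
      "distinct [x, y, p', q', s', t', r, u, v]"
    using st pq assms by auto
  have "reaches 4 (E - ?D) ([x, y] @ [p', q', s', t', r, u, v]) ?css"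
    by (rule reaches_add_low[OF reach]) (use facts deg in auto)
  then have "reaches 4 (E - ?D - {{u, x}, {u, y}}) ([x, y] @ [p', q', s', t', r, u, v])
    (foldr uncolor_edge [edge 9 0 7, edge 9 1 7] ?css)"
    by (rule reaches_uncolor_list) (use assms facts in \<open>auto simp: mask_simps doubleton_eq_iff\<close>)
  moreover have "E - ?D - {{u, x}, {u, y}} = E - ?D'"
    by auto
  ultimately have "reaches 4 (E - ?D') (x # y # [p', q', s', t', r, u, v])
      (foldr uncolor_edge [edge 9 0 7, edge 9 1 7] ?css)"
    by simp
  then show False
    by (rule resolve_mirror_none[OF path_resolves])
        (use assms(3,4,7,8) facts in \<open>simp_all add: mask_simps\<close>)
qed

lemma no_one_shared_with_next:
  assumes "{r, s} \<in> E" "{r, t} \<in> E" "{r, u} \<in> E" "{r, v} \<in> E" "{v, p} \<in> E" "{v, q} \<in> E"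
      "{u, p} \<in> E" "{u, y} \<in> E"
    and dist: "distinct [y, p, q, s, t, r, u, v]"
    and deg: "deg r \<le> 4" "deg s \<le> 3" "deg t \<le> 3" "deg u \<le> 4" "deg v \<le> 4" "deg p \<le> 3" "deg q \<le> 3"
        "deg y \<le> 3"
  shows False
proof -
  obtain s' t' p' q' where st: "s' = s \<and> t' = t \<or> s' = t \<and> t' = s" and pq: "p' = p \<and> q' = q
      \<or> p' = q \<and> q' = p"
    and reach: "reaches 4 (E - {{r, s'}, {r, t'}, {r, u}, {r, v}, {v, p'}, {v, q'}}) [p', q', s',
        t', r, u, v] [pair_position]"
    by (rule pair_normal_form[OF assms(1-6) _ deg(1-7)]) (use dist in \<open>simp\<close>, erule (2) that)
  let ?D = "{{r, s'}, {r, t'}, {r, u}, {r, v}, {v, p'}, {v, q'}}"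
  let ?D' = "{{u, p}, {u, y}, {r, s'}, {r, t'}, {r, u}, {r, v}, {v, p'}, {v, q'}}"
  let ?css = "foldr add_vertices [1] [pair_position]"
  have facts: "{r, s'} \<in> E" "{r, t'} \<in> E" "{v, p'} \<in> E" "{v, q'} \<in> E"
      "distinct [y, p', q', s', t', r, u, v]"
    using st pq assms by auto
  have add: "reaches 4 (E - ?D) ([y] @ [p', q', s', t', r, u, v]) ?css"
    by (rule reaches_add_low[OF reach]) (use facts deg in auto)
  have D: "E - ?D - {{u, p}, {u, y}} = E - ?D'"
    by auto
  from pq show False
  proof
    assume p': "p' = p \<and> q' = q"
    from add have "reaches 4 (E - ?D - {{u, p}, {u, y}}) ([y] @ [p', q', s', t', r, u, v])
      (foldr uncolor_edge [edge 8 0 6, edge 8 1 6] ?css)"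
      by (rule reaches_uncolor_list) (use assms facts p' in \<open>auto simp: mask_simps
          doubleton_eq_iff\<close>)
    then have "reaches 4 (E - ?D') ([y] @ [p', q', s', t', r, u, v]) []"
      unfolding D by (rule resolve[OF path_1_resolves])
          (use assms facts p' in \<open>simp_all add: mask_simps\<close>)
    then show False by simp
  next
    assume q': "p' = q \<and> q' = p"
    from add have "reaches 4 (E - ?D - {{u, p}, {u, y}}) ([y] @ [p', q', s', t', r, u, v])
      (foldr uncolor_edge [edge 8 0 6, edge 8 2 6] ?css)"
      by (rule reaches_uncolor_list) (use assms facts q' in \<open>auto simp: mask_simps
          doubleton_eq_iff\<close>)
    then have "reaches 4 (E - ?D') ([y] @ [p', q', s', t', r, u, v]) []"
      unfolding D by (rule resolve[OF path_2_resolves])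
          (use assms facts q' in \<open>simp_all add: mask_simps\<close>)
    then show False by simp
  qed
qed

lemma no_both_shared:
  assumes "{r, s} \<in> E" "{r, t} \<in> E" "{r, u} \<in> E" "{r, v} \<in> E" "{v, p} \<in> E" "{v, q} \<in> E"
    and u: "{u, p} \<in> E \<and> {u, q} \<in> E \<or> {u, s} \<in> E \<and> {u, t} \<in> E"
    and dist: "distinct [p, q, s, t, r, u, v]"
    and deg: "deg r \<le> 4" "deg s \<le> 3" "deg t \<le> 3" "deg u \<le> 4" "deg v \<le> 4" "deg p \<le> 3" "deg q \<le> 3"
  shows False
proof -
  obtain s' t' p' q' where st: "s' = s \<and> t' = t \<or> s' = t \<and> t' = s" and pq: "p' = p \<and> q' = q
      \<or> p' = q \<and> q' = p"
    and reach: "reaches 4 (E - {{r, s'}, {r, t'}, {r, u}, {r, v}, {v, p'}, {v, q'}}) [p', q', s',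
        t', r, u, v] [pair_position]"
    by (rule pair_normal_form[OF assms(1-6) _ deg(1-7)]) (use dist in \<open>simp\<close>, erule (2) that)
  let ?D = "{{r, s'}, {r, t'}, {r, u}, {r, v}, {v, p'}, {v, q'}}"
  have facts: "{r, s'} \<in> E" "{r, t'} \<in> E" "{v, p'} \<in> E" "{v, q'} \<in> E"
      "distinct [p', q', s', t', r, u, v]"
    using st pq assms by auto
  from u show False
  proof
    assume "{u, p} \<in> E \<and> {u, q} \<in> E"
    then have u': "{u, p'} \<in> E" "{u, q'} \<in> E" using pq by auto
    have "reaches 4 (E - ?D - {{u, p'}, {u, q'}}) [p', q', s', t', r, u, v]
        (foldr uncolor_edge [edge 7 0 5, edge 7 1 5] [pair_position])"
      by (rule reaches_uncolor_list[OF reach])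
          (use assms facts u' in \<open>auto simp: mask_simps doubleton_eq_iff\<close>)
    moreover have "E - ?D - {{u, p'}, {u, q'}} = E - ({{u, p'}, {u, q'}} \<union> ?D)" by auto
    ultimately have "reaches 4 (E - ({{u, p'}, {u, q'}} \<union> ?D)) [p', q', s', t', r, u, v] []"
      by (intro resolve[OF path_12_resolves]) (use assms facts u' in \<open>simp_all add: mask_simps\<close>)
    then show False by simp
  next
    assume "{u, s} \<in> E \<and> {u, t} \<in> E"
    then have u': "{u, s'} \<in> E" "{u, t'} \<in> E" using st by auto
    have "reaches 4 (E - ?D - {{u, s'}, {u, t'}}) [p', q', s', t', r, u, v]
        (foldr uncolor_edge [edge 7 2 5, edge 7 3 5] [pair_position])"
      by (rule reaches_uncolor_list[OF reach])
          (use assms facts u' in \<open>auto simp: mask_simps doubleton_eq_iff\<close>)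
    moreover have "E - ?D - {{u, s'}, {u, t'}} = E - ({{u, s'}, {u, t'}} \<union> ?D)" by auto
    ultimately have "reaches 4 (E - ({{u, s'}, {u, t'}} \<union> ?D)) [p', q', s', t', r, u, v] []"
      by (intro resolve[OF same_lows_resolves]) (use assms facts u' in \<open>simp_all add: mask_simps\<close>)
    then show False by simp
  qed
qed

text \<open>
  This is Vizing's theorem for maximum degree 3: such edge sets are 4-colorable, hence not
  critical.\<close>

lemma exists_degree_4: "\<exists>v. deg v \<ge> 4"
proof (rule ccontr)
  assume "\<not> ?thesis"
  have low: "deg v \<le> 3" for v
  proof -
    have "\<not> deg v \<ge> 4" using \<open>\<not> (\<exists>v. deg v \<ge> 4)\<close> by blast
    then show ?thesis by simp
  qed
  have "E \<noteq> {}"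
    using not_colorable by (auto simp: coloring_def)
  then obtain x y where xy: "{x, y} \<in> E"
    using card_edge by (metis all_not_in_conv card_2_iff)
  define R where "R = nbrs x - {y}"
  have y: "y \<in> nbrs x" using xy by (simp add: nbrs_def)
  have R: "finite R" "card R = deg x - 1" "y \<notin> R" "x \<notin> R" "x \<noteq> y" "deg x \<noteq> 0"
    using finite_nbrs[of x] y not_self_nbr[of x]
    by (auto simp: R_def simp flip: card_nbrs)
  have RE: "z \<in> R \<Longrightarrow> {x, z} \<in> E" for z by (simp add: R_def nbrs_def)
  have "card R \<le> 2" using low[of x] R(2) by simp
  then consider "card R = 0" | "card R = 1" | "card R = 2" by linarith
  then show False
  proof cases
    case 1
    then have "deg x = 1" using R by simp
    then have "reaches 4 (E - {{x, y}}) [y, x] (foldr add_vertices [2,4] [replicate 4 []])"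
      using xy R low[of y] by (intro reaches_start_list) auto
    then have "reaches 4 (E - {{x, y}}) [y, x] []"
      by (rule resolve[OF cubic_1_resolves]) (use xy in \<open>simp_all add: mask_simps\<close>)
    then show False by simp
  next
    case 2
    then obtain z where z: "R = {z}" by (auto simp: card_1_singleton_iff)
    have dx: "deg x = 2" using R 2 by simp
    have "reaches 4 (E - {{x, y}}) [y, z, x] (foldr add_vertices [2,1,3] [replicate 4 []])"
      using xy R low[of y] low[of z] dx z by (intro reaches_start_list) auto
    then have "reaches 4 (E - {{x, y}} - {{x, z}}) [y, z, x] (foldr uncolor_edge [edge 3 1 2]
        (foldr add_vertices [2,1,3] [replicate 4 []]))"
      by (rule reaches_uncolor_list) (use xy RE R z in \<open>auto simp: mask_simps doubleton_eq_iff\<close>)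
    moreover have "E - {{x, y}} - {{x, z}} = E - {{x, y}, {x, z}}" by auto
    ultimately have "reaches 4 (E - {{x, y}, {x, z}}) [y, z, x] []"
      by (intro resolve[OF cubic_2_resolves]) (use xy RE z in \<open>simp_all add: mask_simps\<close>)
    then show False by simp
  next
    case 3
    then obtain z w where z: "R = {z, w}" "z \<noteq> w" by (auto simp: card_2_iff)
    have dx: "deg x = 3" using R 3 by simp
    have zw: "{x, z} \<in> E" "{x, w} \<in> E" using RE z(1) by blast+
    have "reaches 4 (E - {{x, y}}) [y, z, w, x] (foldr add_vertices [2,1,1,2] [replicate 4 []])"
      using xy R low[of y] low[of z] low[of w] dx z by (intro reaches_start_list) auto
    then have "reaches 4 (E - {{x, y}} - {{x, z}, {x, w}}) [y, z, w, x]
        (foldr uncolor_edge [edge 4 1 3, edge 4 2 3]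
        (foldr add_vertices [2,1,1,2] [replicate 4 []]))"
      by (rule reaches_uncolor_list) (use xy zw R z in \<open>auto simp: mask_simps doubleton_eq_iff\<close>)
    moreover have "E - {{x, y}} - {{x, z}, {x, w}} = E - {{x, y}, {x, z}, {x, w}}" by auto
    ultimately have "reaches 4 (E - {{x, y}, {x, z}, {x, w}}) [y, z, w, x] []"
      by (intro resolve[OF cubic_3_resolves]) (use xy zw in \<open>simp_all add: mask_simps\<close>)
    then show False by simp
  qed
qed

end

section \<open>Critical edge sets whose vertices of degree 4 have at most two neighbors of degree 4\<close>

locale critical_thin_core = critical +
  assumes deg_le_4: "deg v \<le> 4"
    and core_degree: "deg v = 4 \<Longrightarrow> card {w \<in> nbrs v. deg w = 4} \<le> 2"
begin

definition star :: "'a \<Rightarrow> 'a \<Rightarrow> 'a \<Rightarrow> 'a \<Rightarrow> 'a \<Rightarrow> bool" where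
  "star r s t u v \<longleftrightarrow> distinct [s, t, r, u, v] \<and> nbrs r = {s, t, u, v} \<and>
     deg r = 4 \<and> deg s = 3 \<and> deg t = 3 \<and> deg u = 4 \<and> deg v = 4"

lemma star_swap: "star r s t u v \<Longrightarrow> star r t s u v" "star r s t u v \<Longrightarrow> star r s t v u"
  by (auto simp: star_def)

lemma star_edges: "star r s t u v \<Longrightarrow> {r, s} \<in> E \<and> {r, t} \<in> E \<and> {r, u} \<in> E \<and> {r, v} \<in> E"
  unfolding star_def nbrs_def by blast

lemma star_exists:
  assumes r: "deg r = 4"
  obtains s t u v where "star r s t u v"
proof -
  define L where "L = {w \<in> nbrs r. deg w \<le> 3}"
  define C where "C = {w \<in> nbrs r. deg w = 4}"
  have fin: "finite L" "finite C"
    using finite_nbrs by (auto simp: L_def C_def)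
  have "deg w \<le> 3 \<or> deg w = 4" for w
    using deg_le_4[of w] by linarith
  then have N: "nbrs r = L \<union> C" "L \<inter> C = {}"
    by (auto simp: L_def C_def)
  have "card L + card C = 4"
    using card_Un_disjoint[OF fin N(2)] N(1) card_nbrs[of r] r by simp
  moreover have "card C \<le> 2"
    using core_degree[OF r] by (simp add: C_def)
  moreover have "\<not> card L \<ge> 3"
  proof
    assume "card L \<ge> 3"
    then obtain T where T: "T \<subseteq> L" "card T = 3"
      by (meson obtain_subset_with_card_n)
    then obtain y1 y2 y3 where y: "T = {y1, y2, y3}" "y1 \<noteq> y2" "y2 \<noteq> y3" "y1 \<noteq> y3"
      by (auto simp: card_3_iff)
    have "T \<noteq> nbrs r"
      using T(2) card_nbrs[of r] r by auto
    then obtain u where u: "u \<in> nbrs r" "u \<notin> T"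
      using T(1) N(1) by blast
    show False
    proof (rule no_three_low_neighbors[of r y1 y2 y3 u])
      show "distinct [y1, y2, y3, r, u]"
        using y u T(1) not_self_nbr[of r] by (auto simp: L_def)
    qed (use y u T(1) deg_le_4 in \<open>auto simp: L_def nbrs_def\<close>)
  qed
  ultimately have "card L = 2" "card C = 2" by auto
  then obtain s t u v where st: "L = {s, t}" "s \<noteq> t" and uv: "C = {u, v}" "u \<noteq> v"
    by (auto simp: card_2_iff)
  have dist: "distinct [s, t, r, u, v]"
    using st uv N(2) not_self_nbr[of r] by (auto simp: L_def C_def)
  have E: "{r, s} \<in> E" "{r, t} \<in> E" "{r, u} \<in> E" "{r, v} \<in> E"
    using N(1) st(1) uv(1) unfolding nbrs_def by blast+
  have low: "deg s \<le> 3" "deg t \<le> 3" "deg u = 4" "deg v = 4"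
    using st(1) uv(1) unfolding L_def C_def by blast+
  have dist': "distinct [t, s, r, u, v]"
    using dist by auto
  have "deg s = 3"
  proof (rule ccontr)
    assume "deg s \<noteq> 3"
    then show False
      using no_degree_2_neighbor[of r s t u v] E dist low deg_le_4 by simp
  qed
  moreover have "deg t = 3"
  proof (rule ccontr)
    assume "deg t \<noteq> 3"
    then show False
      using no_degree_2_neighbor[of r t s u v] E dist' low deg_le_4 by simp
  qed
  ultimately have "star r s t u v"
    unfolding star_def using dist r low(3,4) N(1) st(1) uv(1) by auto
  then show thesis by (rule that)
qed

lemma star_at_neighbor:
  assumes "star r s t u v"
  obtains p q w where "star v p q r w"
proof -
  have "deg v = 4"
    using assms by (simp add: star_def)
  then obtain p q a b where *: "star v p q a b"
    by (rule star_exists)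
  have "r \<in> nbrs v"
    using assms nbrs_sym[of r v] by (auto simp: star_def)
  then have "r = a \<or> r = b"
    using * assms by (auto simp: star_def)
  then show thesis
    using * star_swap(2) that by blast
qed

lemma single_overlap:
  assumes rs: "star r s t u v" and vs: "star v s q r w"
  shows "q = t"
proof (rule ccontr)
  assume "q \<noteq> t"
  then have "distinct [q, s, t, r, u, v]"
    using rs vs by (auto simp: star_def)
  then show False
    using no_single_shared_neighbor[of r s t u v q] star_edges[OF rs] star_edges[OF vs] rs vs
        by (simp add: star_def)
qed

lemma overlap_imp_same:
  assumes rs: "star r s t u v" and vs: "star v p q r w" and "p \<in> {s, t} \<or> q \<in> {s, t}"
  shows "{p, q} = {s, t}"
  using assms(3) single_overlap star_swap(1) rs vs by blast

text \<open>
  A single common neighbor is excluded by \<open>overlap_imp_same\<close>. If there is none, the other neighbor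
  \<open>u\<close> of \<open>r\<close> of degree 4 shares both or none with \<open>r\<close>, and all positions of its neighbors relative
  to those of \<open>v\<close> are excluded by the game on the path \<open>u\<close>, \<open>r\<close>, \<open>v\<close>.\<close>

lemma same_low_neighbors:
  assumes rs: "star r s t u v" and vs: "star v p q r w"
  shows "{p, q} = {s, t}"
proof (rule ccontr)
  assume "{p, q} \<noteq> {s, t}"
  then have pq: "p \<notin> {s, t}" "q \<notin> {s, t}"
    using overlap_imp_same[OF rs vs] by blast+
  obtain x y w' where us: "star u x y r w'"
    by (rule star_at_neighbor[OF star_swap(2)[OF rs]])
  note E = star_edges[OF rs] star_edges[OF vs] star_edges[OF us]
  have R: "distinct [s, t, r, u, v]" "deg r = 4" "deg s = 3" "deg t = 3" "deg u = 4" "deg v = 4"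
    "distinct [p, q, v, r, w]" "deg p = 3" "deg q = 3" "distinct [x, y, u, r, w']" "deg x = 3"
        "deg y = 3"
    using rs vs us by (simp_all add: star_def)
  have "p \<noteq> u" "q \<noteq> u" "x \<noteq> v" "y \<noteq> v"
    using R by auto
  then have d1: "distinct [p, q, s, t, r, u, v]" and d2: "x \<noteq> y" "x \<notin> {r, u, v}" "y \<notin> {r, u, v}"
    using R pq by simp_all
  have "\<not> ({x, y} = {s, t} \<or> {x, y} = {p, q})"
  proof
    assume "{x, y} = {s, t} \<or> {x, y} = {p, q}"
    then have "{u, p} \<in> E \<and> {u, q} \<in> E \<or> {u, s} \<in> E \<and> {u, t} \<in> E"
      using E(3) by (auto simp: doubleton_eq_iff)
    then show False
      using no_both_shared[of r s t u v p q] E d1 R by simp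
  qed
  then have n: "x \<notin> {s, t}" "y \<notin> {s, t}" "{x, y} \<noteq> {p, q}"
    using overlap_imp_same[OF star_swap(2)[OF rs] us] by blast+
  have d3: "distinct [y, p, q, s, t, r, u, v]" "distinct [y, q, p, s, t, r, u, v]" if "y \<notin> {p, q}"
    using d1 d2 n(2) that by auto
  have d4: "distinct [x, p, q, s, t, r, u, v]" "distinct [x, q, p, s, t, r, u, v]" if "x \<notin> {p, q}"
    using d1 d2 n(1) that by auto
  consider "x = p" "y \<notin> {p, q}" | "x = q" "y \<notin> {p, q}" | "y = p" "x \<notin> {p, q}" | "y = q" "x \<notin> {p, q}"
    | "x \<notin> {p, q}" "y \<notin> {p, q}"
    using n(3) d2(1) by blast
  then show False
  proof cases
    case 1
    then show False using no_one_shared_with_next[of r s t u v p q y] E d3 R by simp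
  next
    case 2
    then show False using no_one_shared_with_next[of r s t u v q p y] E d3 R by simp
  next
    case 3
    then show False using no_one_shared_with_next[of r s t u v p q x] E d4 R by simp
  next
    case 4
    then show False using no_one_shared_with_next[of r s t u v q p x] E d4 R by simp
  next
    case 5
    then have "distinct [x, y, p, q, s, t, r, u, v]"
      using d2(1) d3 d4 by simp
    then show False
      using no_disjoint_low_neighbors[of r s t u v p q x y] E R by simp
  qed
qed

lemma low_neighbors_shared:
  assumes rs: "star r s t u v"
  shows "{s, v} \<in> E \<and> {t, v} \<in> E"
proof -
  obtain p q w where vs: "star v p q r w"
    by (rule star_at_neighbor[OF rs])
  show ?thesis
    using same_low_neighbors[OF rs vs] star_edges[OF vs]
        by (auto simp: doubleton_eq_iff insert_commute)
qed

lemma nbrs_low: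
  assumes rs: "star r s t u v"
  shows "nbrs s = {r, u, v}"
proof -
  have "{r, u, v} \<subseteq> nbrs s"
    using star_edges[OF rs] low_neighbors_shared[OF rs] low_neighbors_shared[OF star_swap(2)[OF rs]]
    by (auto simp: nbrs_def insert_commute)
  moreover have "card {r, u, v} = card (nbrs s)"
    using rs by (simp add: star_def card_nbrs)
  ultimately show ?thesis
    using card_subset_eq[OF finite_nbrs] by metis
qed

text \<open>
  Let \<open>w\<close> be the neighbor of \<open>v\<close> of degree 4 other than \<open>r\<close>. It has the same neighbors of degree 3
  as \<open>v\<close>, so it is one of the three neighbors of \<open>s\<close>, and only \<open>u\<close> is left.\<close>

lemma nbrs_high:
  assumes rs: "star r s t u v"
  shows "nbrs v = {s, t, r, u}"
proof -
  obtain p q w where vs: "star v p q r w"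
    by (rule star_at_neighbor[OF rs])
  have pq: "{p, q} = {s, t}"
    using same_low_neighbors[OF rs vs] .
  have "{p, w} \<in> E" "{q, w} \<in> E"
    using low_neighbors_shared[OF vs] by auto
  then have "{s, w} \<in> E"
    using pq by (auto simp: doubleton_eq_iff)
  then have "w \<in> {r, u, v}"
    using nbrs_low[OF rs] by (auto simp: nbrs_def)
  then have "w = u"
    using vs by (auto simp: star_def)
  then show ?thesis
    using vs pq by (auto simp: star_def)
qed

lemma K5_minus_edge_structure:
  obtains r s t u v where "distinct [s, t, r, u, v]"
    "nbrs s = {r, u, v}" "nbrs t = {r, u, v}"
    "nbrs r = {s, t, u, v}" "nbrs u = {s, t, r, v}" "nbrs v = {s, t, r, u}"
proof -
  obtain r where "deg r = 4"
    using exists_degree_4 deg_le_4 by (meson le_antisym)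
  then obtain s t u v where rs: "star r s t u v"
    using star_exists by blast
  show thesis
    using that[of s t r u v] nbrs_low[OF rs] nbrs_low[OF star_swap(1)[OF rs]] nbrs_high[OF rs]
      nbrs_high[OF star_swap(2)[OF rs]] rs by (auto simp: star_def)
qed

end

section \<open>Class 2 graphs\<close>

lemma coloring_edge_colorable: "edge_colorable G k \<longleftrightarrow> (\<exists>c. coloring k (edges G) c)"
  unfolding edge_colorable_def proper_edge_coloring_def coloring_def image_subset_iff lessThan_iff
      by blast

lemma simple_graph_edge: "\<lbrakk>simple_graph G; e \<in> edges G\<rbrakk> \<Longrightarrow> e \<subseteq> verts G \<and> card e = 2"
  unfolding simple_graph_def nsets_def by blast

lemma degree_le_max_degree:
  "\<lbrakk>simple_graph G; v \<in> verts G\<rbrakk> \<Longrightarrow> vertex_degree G v \<le> max_degree G"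
  unfolding max_degree_def simple_graph_def by (intro Max_ge) auto

lemma max_degree_attained:
  assumes "simple_graph G" "max_degree G \<noteq> 0"
  obtains v where "v \<in> verts G" "vertex_degree G v = max_degree G"
proof -
  have "max_degree G \<in> insert 0 (vertex_degree G ` verts G)"
    unfolding max_degree_def using assms(1) by (intro Max_in) (auto simp: simple_graph_def)
  then show thesis
    using assms(2) that by auto
qed

lemma max_degree_le_chromatic_index:
  assumes "simple_graph G"
  shows "max_degree G \<le> chromatic_index G"
proof (cases "max_degree G = 0")
  case False
  then obtain v where v: "v \<in> verts G" "vertex_degree G v = max_degree G"
    using max_degree_attained[OF assms] by blast
  obtain c where c: "coloring (chromatic_index G) (edges G) c"
    using edge_colorable_chromatic_index[OF assms] coloring_edge_colorable by blast
  let ?I = "{e \<in> edges G. v \<in> e}"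
  have "inj_on c ?I"
    using c unfolding coloring_def inj_on_def by blast
  moreover have "c ` ?I \<subseteq> {..<chromatic_index G}"
    using c unfolding coloring_def by blast
  ultimately have "card ?I \<le> card {..<chromatic_index G}"
    by (intro card_inj_on_le) auto
  then show ?thesis
    using v(2) by (simp add: vertex_degree_def)
qed simp

lemma class2_iff_not_colorable:
  assumes "simple_graph G"
  shows "class2 G \<longleftrightarrow> \<not> (\<exists>c. coloring (max_degree G) (edges G) c)"
proof -
  have "chromatic_index G = max_degree G" if "edge_colorable G (max_degree G)"
    using max_degree_le_chromatic_index[OF assms] that
    unfolding chromatic_index_def by (intro antisym Least_le)
  moreover have "edge_colorable G (max_degree G)" if "chromatic_index G = max_degree G"
    using edge_colorable_chromatic_index[OF assms] that by simp
  ultimately show ?thesis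
    unfolding class2_def class1_def coloring_edge_colorable by blast
qed

lemma critical_subset_exists:
  assumes "finite E" "\<And>e. e \<in> E \<Longrightarrow> card e = 2" "\<not> (\<exists>c. coloring 4 E c)"
  obtains F where "F \<subseteq> E" "critical F"
proof -
  let ?P = "\<lambda>F. F \<subseteq> E \<and> \<not> (\<exists>c. coloring 4 F c)"
  define F where "F = (ARG_MIN card F. ?P F)"
  have F: "?P F" and least: "card F \<le> card F'" if "?P F'" for F'
    using arg_min_natI[of ?P E card] arg_min_nat_le[of ?P F' card] assms(3) that
    unfolding F_def by blast+
  have "?P F" using F[of E] assms(3) by blast
  moreover have "critical F"
  proof
    show "finite F"
      using \<open>?P F\<close> assms(1) finite_subset by blast
    show "card e = 2" if "e \<in> F" for e
      using \<open>?P F\<close> assms(2) that by blast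
    show "\<not> coloring 4 F c" for c
      using \<open>?P F\<close> by blast
    show "\<exists>c. coloring 4 (F - {e}) c" if "e \<in> F" for e
    proof (rule ccontr)
      assume "\<nexists>c. coloring 4 (F - {e}) c"
      then have "card F \<le> card (F - {e})"
        using least[of "F - {e}"] \<open>?P F\<close> by blast
      then show False
        using \<open>finite F\<close> that by (metis card_Diff1_less not_le)
    qed
  qed
  ultimately show thesis
    using that by blast
qed

lemma isomorphic_if_K5_minus_edge_pattern:
  assumes V: "verts G = {s, t, r, u, v}" and dist: "distinct [s, t, r, u, v]"
    and adj: "\<And>x y. \<lbrakk>x \<in> verts G; y \<in> verts G\<rbrakk> \<Longrightarrow> adjacent G x y \<longleftrightarrow> x \<noteq> y \<and> {x, y} \<noteq> {s, t}"
  shows "graph_isomorphic G K5_minus_edge"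
proof -
  define f where "f x = (if x = s then 0 else if x = t then 1 else if x = r then 2 else
      if x = u then 3 else 4 :: nat)" for x
  have f: "f s = 0" "f t = 1" "f r = 2" "f u = 3" "f v = 4"
    using dist by (auto simp: f_def)
  have "inj_on f (verts G)"
    using dist unfolding V by (auto simp: inj_on_def f)
  moreover have "f ` verts G = {..<5}"
    unfolding V by (auto simp: f)
  ultimately have bij: "bij_betw f (verts G) (verts K5_minus_edge)"
    by (simp add: bij_betw_def K5_minus_edge_def delete_edge_def complete_graph_def)
  have "adjacent G x y \<longleftrightarrow> adjacent K5_minus_edge (f x) (f y)" if xy: "x \<in> verts G" "y \<in> verts G"
      for x y
  proof -
    have "f x < 5" "f y < 5"
      by (auto simp: f_def)
    then have "adjacent K5_minus_edge (f x) (f y) \<longleftrightarrow> f x \<noteq> f y \<and> {f x, f y} \<noteq> {f s, f t}"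
      by (auto simp: adjacent_def K5_minus_edge_def delete_edge_def complete_graph_def nsets_def f
          card_insert_if)
    moreover have "f x = f y \<longleftrightarrow> x = y"
      using \<open>inj_on f (verts G)\<close> xy by (rule inj_on_eq_iff)
    moreover have "{x, y} \<subseteq> verts G" "{s, t} \<subseteq> verts G"
      using xy V by auto
    then have "f ` {x, y} = f ` {s, t} \<longleftrightarrow> {x, y} = {s, t}"
      by (rule inj_on_image_eq_iff[OF \<open>inj_on f (verts G)\<close>])
    then have "{f x, f y} = {f s, f t} \<longleftrightarrow> {x, y} = {s, t}"
      by (simp only: image_insert image_empty)
    ultimately show ?thesis
      unfolding adj[OF xy] by blast
  qed
  then show ?thesis
    unfolding graph_isomorphic_def using bij by blast
qed

lemma K5_minus_edge_not_colorable:
  assumes G: "simple_graph G" and iso: "graph_isomorphic G K5_minus_edge"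
  shows "\<not> (\<exists>c. coloring 4 (edges G) c)"
proof
  assume "\<exists>c. coloring 4 (edges G) c"
  then obtain c where c: "coloring 4 (edges G) c" by blast
  let ?K = "K5_minus_edge"
  obtain f where f: "bij_betw f (verts G) (verts ?K)"
    and adj: "\<And>u v. \<lbrakk>u \<in> verts G; v \<in> verts G\<rbrakk> \<Longrightarrow> adjacent G u v \<longleftrightarrow> adjacent ?K (f u) (f v)"
    using iso unfolding graph_isomorphic_def by blast
  have vK: "verts ?K = {..<5}" and eK: "edges ?K = nsets {..<5} 2 - {{0, 1}}"
    by (simp_all add: K5_minus_edge_def delete_edge_def complete_graph_def)
  have V: "card (verts G) = 5"
    using bij_betw_same_card[OF f] vK by simp
  have edgeG: "\<exists>x y. e = {x, y} \<and> x \<in> verts G \<and> y \<in> verts G" if "e \<in> edges G" for e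
    using simple_graph_edge[OF G that] by (auto simp: card_2_iff)
  have "(\<lambda>e. f ` e) ` edges G = edges ?K"
  proof (intro equalityI subsetI)
    fix e' assume "e' \<in> (\<lambda>e. f ` e) ` edges G"
    then obtain e where e: "e \<in> edges G" "e' = f ` e" by blast
    then obtain x y where "e = {x, y}" "x \<in> verts G" "y \<in> verts G"
      using edgeG by blast
    then show "e' \<in> edges ?K"
      using e adj[of x y] by (simp add: adjacent_def)
  next
    fix e' assume e': "e' \<in> edges ?K"
    then obtain a b where ab: "e' = {a, b}" "a \<in> verts ?K" "b \<in> verts ?K"
      unfolding eK vK nsets_def by (auto simp: card_2_iff)
    then obtain x y where "a = f x" "b = f y" "x \<in> verts G" "y \<in> verts G"
      using f unfolding bij_betw_def by blast
    then have "{x, y} \<in> edges G" "e' = f ` {x, y}"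
      using e' ab adj[of x y] by (simp_all add: adjacent_def)
    then show "e' \<in> (\<lambda>e. f ` e) ` edges G" by blast
  qed
  moreover have "inj_on (\<lambda>e. f ` e) (edges G)"
    using f simple_graph_edge[OF G] unfolding bij_betw_def
    by (intro inj_onI) (metis inj_on_image_eq_iff)
  ultimately have "card (edges G) = card (edges ?K)"
    using card_image by metis
  also have "\<dots> = 9"
  proof -
    have "{0, 1} \<in> nsets {..<5 :: nat} 2"
      by (simp add: nsets_def)
    then show ?thesis
      unfolding eK by (simp add: card_Diff_singleton card_nsets numeral_eq_Suc)
  qed
  finally have nine: "card (edges G) = 9" .
  have two: "card {e \<in> edges G. c e = i} \<le> 2" for i
  proof -
    let ?M = "{e \<in> edges G. c e = i}"
    have fin: "finite ?M"
      using simple_graph_finite_edges[OF G] by simp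
    have "card (\<Union> ?M) = (\<Sum>e\<in>?M. card e)"
    proof (rule card_Union_disjoint)
      show "pairwise disjnt ?M"
        using c unfolding coloring_def pairwise_def disjnt_def by blast
    qed (use simple_graph_edge[OF G] card.infinite in force)
    also have "\<dots> = 2 * card ?M"
      using simple_graph_edge[OF G] by simp
    finally have "2 * card ?M = card (\<Union> ?M)" by simp
    also have "\<dots> \<le> card (verts G)"
      using G simple_graph_edge[OF G] by (intro card_mono) (auto simp: simple_graph_def)
    finally show ?thesis
      using V by simp
  qed
  have "edges G = (\<Union>i<4. {e \<in> edges G. c e = i})"
    using c unfolding coloring_def by auto
  then have "card (edges G) \<le> (\<Sum>i<4::nat. card {e \<in> edges G. c e = i})"
    using card_UN_le[of "{..<4::nat}" "\<lambda>i. {e \<in> edges G. c e = i}"] by simp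
  also have "\<dots> \<le> (\<Sum>i<4::nat. 2)"
    using two by (intro sum_mono)
  finally show False
    using nine by simp
qed

text \<open>
  The critical set \<open>E\<close> inherits the bound on the core, since a vertex of degree 4 in \<open>E\<close> has
  degree 4 in \<open>G\<close>. On the five vertices of the \<open>K\<^sub>5 - e\<close> found in \<open>E\<close>, the graph has no edges
  outside \<open>E\<close>, so by connectedness there are no other vertices.\<close>

lemma class2_imp_K5_minus_edge:
  assumes G: "simple_graph G" and conn: "connected_graph G" and max: "max_degree G = 4"
    and core: "max_degree (core G) \<le> 2" and not_col: "\<not> (\<exists>c. coloring 4 (edges G) c)"
  shows "graph_isomorphic G K5_minus_edge"
proof -
  have finE: "finite (edges G)"
    using simple_graph_finite_edges[OF G] .
  obtain E where sub: "E \<subseteq> edges G" and "critical E"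
    using critical_subset_exists[OF finE _ not_col] simple_graph_edge[OF G] by blast
  interpret critical E by fact
  have deg_le: "deg x \<le> vertex_degree G x" for x
    unfolding deg_def vertex_degree_def using finE sub by (intro card_mono) auto
  have vdeg_le: "vertex_degree G x \<le> 4" for x
  proof (cases "x \<in> verts G")
    case True
    then show ?thesis using degree_le_max_degree[OF G] max by metis
  next
    case False
    then have "{e \<in> edges G. x \<in> e} = {}"
      using simple_graph_edge[OF G] by blast
    then show ?thesis unfolding vertex_degree_def by (simp only: card.empty)
  qed
  have nbr_verts: "y \<in> verts G \<and> x \<in> verts G" if "{x, y} \<in> edges G" for x y
    using simple_graph_edge[OF G that] by simp
  have core_simple: "simple_graph (core G)"
    using G by (auto simp: simple_graph_def core_def induced_subgraph_def nsets_def)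
  have core_bound: "card A \<le> 2" if v: "vertex_degree G v = 4" and A: "\<And>w. w \<in> A \<Longrightarrow> {v, w} \<in> edges G
      \<and> vertex_degree G w = 4" for v A
  proof (cases "A = {}")
    case False
    then have vG: "v \<in> verts G"
      using A nbr_verts by blast
    then have "v \<in> verts (core G)"
      using v max by (simp add: core_def induced_subgraph_def)
    then have "vertex_degree (core G) v \<le> 2"
      using degree_le_max_degree[OF core_simple] core by (meson le_trans)
    moreover have "(\<lambda>w. {v, w}) ` A \<subseteq> {e \<in> edges (core G). v \<in> e}"
      using A nbr_verts vG v max by (auto simp: core_def induced_subgraph_def)
    then have "card ((\<lambda>w. {v, w}) ` A) \<le> vertex_degree (core G) v"
      unfolding vertex_degree_def using simple_graph_finite_edges[OF core_simple]
          by (intro card_mono) auto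
    ultimately show ?thesis
      by (simp add: card_image inj_on_edge)
  qed simp
  interpret critical_thin_core E
  proof
    show "deg v \<le> 4" for v
      using deg_le vdeg_le le_trans by blast
    show "card {w \<in> nbrs v. deg w = 4} \<le> 2" if "deg v = 4" for v
    proof (rule core_bound)
      have four: "vertex_degree G w = 4" if "deg w = 4" for w
        using deg_le[of w] vdeg_le[of w] that by simp
      then show "vertex_degree G v = 4" using \<open>deg v = 4\<close> .
      show "{v, w} \<in> edges G \<and> vertex_degree G w = 4" if "w \<in> {w \<in> nbrs v. deg w = 4}" for w
        using that four sub by (auto simp: nbrs_def)
    qed
  qed
  obtain r s t u v where dist: "distinct [s, t, r, u, v]"
    and N: "nbrs s = {r, u, v}" "nbrs t = {r, u, v}"
      "nbrs r = {s, t, u, v}" "nbrs u = {s, t, r, v}" "nbrs v = {s, t, r, u}"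
    using K5_minus_edge_structure .
  let ?S = "{s, t, r, u, v}"
  have degs: "deg r = 4" "deg u = 4" "deg v = 4" "deg s = 3" "deg t = 3"
    unfolding card_nbrs[symmetric] N using dist by simp_all
  have high: "vertex_degree G x = 4" if "x \<in> {r, u, v}" for x
    using deg_le[of x] vdeg_le[of x] degs that by auto
  \<comment> \<open>With degree 4 in \<open>G\<close>, \<open>x\<close> would belong to the core and have the neighbors \<open>r\<close>, \<open>u\<close>, \<open>v\<close> there.\<close>
  have low: "vertex_degree G x = 3" if "x \<in> {s, t}" for x
  proof -
    have "vertex_degree G x \<noteq> 4"
    proof
      assume "vertex_degree G x = 4"
      moreover have "{x, w} \<in> edges G \<and> vertex_degree G w = 4" if "w \<in> {r, u, v}" for w
        using N(1,2) \<open>x \<in> {s, t}\<close> that sub high[OF that] unfolding nbrs_def by blast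
      ultimately have "card {r, u, v} \<le> 2"
        by (rule core_bound)
      then show False using dist by simp
    qed
    then show ?thesis
      using deg_le[of x] vdeg_le[of x] degs that by auto
  qed
  have saturated: "{x, y} \<in> edges G \<longleftrightarrow> y \<in> nbrs x" if "x \<in> ?S" for x y
  proof -
    have "{e \<in> E. x \<in> e} = {e \<in> edges G. x \<in> e}"
    proof (rule card_subset_eq)
      show "card {e \<in> E. x \<in> e} = card {e \<in> edges G. x \<in> e}"
        using high[of x] low[of x] degs that unfolding deg_def vertex_degree_def by auto
    qed (use finE sub in auto)
    then show ?thesis
      unfolding nbrs_def by blast
  qed
  have closed: "y \<in> ?S" if "x \<in> ?S" "adjacent G x y" for x y
    using saturated[OF that(1), of y] that N unfolding adjacent_def by auto
  have "r \<in> verts G"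
    using saturated[of r s] N nbr_verts[of r s] by simp
  have "x \<in> ?S" if "x \<in> verts G" for x
  proof -
    have "(adjacent G)\<^sup>*\<^sup>* r x"
      using conn that \<open>r \<in> verts G\<close> unfolding connected_graph_def by blast
    then show ?thesis
      by (induction rule: rtranclp_induct) (simp, rule closed)
  qed
  moreover have "?S \<subseteq> verts G"
    using saturated[of r] N nbr_verts[of r] \<open>r \<in> verts G\<close> by auto
  ultimately have V: "verts G = ?S" by blast
  show ?thesis
  proof (rule isomorphic_if_K5_minus_edge_pattern[OF V dist])
    fix x y assume "x \<in> verts G" "y \<in> verts G"
    then have "x \<in> ?S" "y \<in> ?S" using V by simp_all
    have "adjacent G x y \<longleftrightarrow> y \<in> nbrs x"
      using saturated[OF \<open>x \<in> ?S\<close>] by (simp add: adjacent_def)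
    also have "\<dots> \<longleftrightarrow> x \<noteq> y \<and> {x, y} \<noteq> {s, t}"
      using \<open>x \<in> ?S\<close> \<open>y \<in> ?S\<close> dist by (elim insertE emptyE) (auto simp: N doubleton_eq_iff)
    finally show "adjacent G x y \<longleftrightarrow> x \<noteq> y \<and> {x, y} \<noteq> {s, t}" .
  qed
qed

theorem theorem3p3:
  fixes G :: "'a graph"
  assumes "simple_graph G"
    and "connected_graph G"
    and "max_degree G = 4"
    and "max_degree (core G) \<le> 2"
  shows "class2 G \<longleftrightarrow> graph_isomorphic G K5_minus_edge"
  using class2_imp_K5_minus_edge[OF assms] K5_minus_edge_not_colorable[OF assms(1)]
    class2_iff_not_colorable[OF assms(1)] assms(3) by auto

end
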